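(* Let $\dot{G}=(G,\sigma)$ be an unbalanced signed graph of order $n$, and let $k$ be an integer with $3 \le k \le (n-11)/10$. If $\dot{G}$ is $C_{2k+1}^{-}$-free, then $$\rho(\dot{G}) \le \rho(C_{3}^{-} \cdot K_{n-2}),$$ with equality if and only if $\dot{G}$ is switching equivalent to $C_{3}^{-} \cdot K_{n-2}$.
   Context: All graphs are finite, simple and undirected. A signed graph $\dot{G}=(G,\sigma)$ is a graph $G$ together with a sign function $\sigma:E(G)\to\{+1,-1\}$. Its adjacency matrix $A(\dot{G})=(\sigma_{ij})$ has $\sigma_{ij}=\sigma(v_iv_j)$ if $v_i\sim v_j$ and $0$ otherwise; its eigenvalues are $\lambda_1(\dot G)\ge\cdots\ge\lambda_n(\dot G)$ and its spectral radius is $\rho(\dot{G})=\max\{\lambda_1(\dot G),-\lambda_n(\dot G)\}$. The sign of a cycle is the product of the signs of its edges; $C_l^-$ denotes a negative cycle of length $l$. For $U\subseteq V(G)$, switching at $U$ reverses the sign of every edge between $U$ and $V(G)\setminus U$; two signed graphs are switching equivalent if one is obtained from the other by such a switching. A signed graph is balanced if it is switching equivalent to one with all edges positive, and unbalanced otherwise. A signed graph is $C_{2k+1}^-$-free if it has no subgraph switching equivalent to $C_{2k+1}^-$ (i.e., no negative cycle of length $2k+1$). $C_3^-\cdot K_{n-2}$ denotes the signed graph obtained from a negative triangle $C_3^-$ and an all-positive complete graph $(K_{n-2},+)$ by identifying one vertex of the triangle with one vertex of $K_{n-2}$. *)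

theory Defs
  imports Complex_Main "Jordan_Normal_Form.Char_Poly"
begin

text \<open>Only the values of \<open>sg_sign\<close> on edges are meaningful.\<close>

record 'a sgraph =
  sg_verts :: "'a set"
  sg_edges :: "'a set set"
  sg_sign  :: "'a set \<Rightarrow> int"

definition signed_graph :: "'a sgraph \<Rightarrow> bool" where
  "signed_graph G \<longleftrightarrow>
     finite (sg_verts G) \<and>
     (\<forall>e\<in>sg_edges G. e \<subseteq> sg_verts G \<and> card e = 2) \<and>
     (\<forall>e\<in>sg_edges G. sg_sign G e = 1 \<or> sg_sign G e = -1)"

definition sg_order :: "'a sgraph \<Rightarrow> nat" where
  "sg_order G = card (sg_verts G)"

definition adj_entry :: "'a sgraph \<Rightarrow> 'a \<Rightarrow> 'a \<Rightarrow> real" where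
  "adj_entry G u v = (if {u, v} \<in> sg_edges G then of_int (sg_sign G {u, v}) else 0)"

text \<open>The list \<open>vs\<close> is the enumeration of the vertices that labels the rows and columns.\<close>

definition adj_matrix :: "'a sgraph \<Rightarrow> 'a list \<Rightarrow> real mat" where
  "adj_matrix G vs =
     mat (length vs) (length vs) (\<lambda>(i, j). adj_entry G (vs ! i) (vs ! j))"

definition sg_eigenvalues :: "'a sgraph \<Rightarrow> real set" where
  "sg_eigenvalues G =
     {x. \<exists>vs. distinct vs \<and> set vs = sg_verts G \<and> eigenvalue (adj_matrix G vs) x}"

definition sg_spectral_radius :: "'a sgraph \<Rightarrow> real" where
  "sg_spectral_radius G = max (Max (sg_eigenvalues G)) (- Min (sg_eigenvalues G))"

definition switch :: "'a set \<Rightarrow> 'a sgraph \<Rightarrow> 'a sgraph" where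
  "switch U G = G\<lparr>sg_sign := (\<lambda>e.
     if \<exists>u\<in>U. \<exists>v\<in>sg_verts G - U. e = {u, v} then - sg_sign G e else sg_sign G e)\<rparr>"

definition sg_isomorphic :: "'a sgraph \<Rightarrow> 'b sgraph \<Rightarrow> bool" where
  "sg_isomorphic G H \<longleftrightarrow>
     (\<exists>f. bij_betw f (sg_verts G) (sg_verts H) \<and>
          sg_edges H = (\<lambda>e. f ` e) ` sg_edges G \<and>
          (\<forall>e\<in>sg_edges G. sg_sign H (f ` e) = sg_sign G e))"

text \<open>As usual, signed graphs are identified when they are isomorphic.\<close>

definition switching_equivalent :: "'a sgraph \<Rightarrow> 'b sgraph \<Rightarrow> bool" where
  "switching_equivalent G H \<longleftrightarrow> (\<exists>U\<subseteq>sg_verts G. sg_isomorphic (switch U G) H)"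

definition balanced :: "'a sgraph \<Rightarrow> bool" where
  "balanced G \<longleftrightarrow>
     (\<exists>H :: 'a sgraph. signed_graph H \<and> switching_equivalent G H \<and>
        (\<forall>e\<in>sg_edges H. sg_sign H e = 1))"

definition cycle_edge :: "'a list \<Rightarrow> nat \<Rightarrow> 'a set" where
  "cycle_edge vs i = {vs ! i, vs ! (Suc i mod length vs)}"

definition is_cycle :: "'a sgraph \<Rightarrow> 'a list \<Rightarrow> bool" where
  "is_cycle G vs \<longleftrightarrow>
     3 \<le> length vs \<and> distinct vs \<and> set vs \<subseteq> sg_verts G \<and>
     (\<forall>i<length vs. cycle_edge vs i \<in> sg_edges G)"

definition cycle_sign :: "'a sgraph \<Rightarrow> 'a list \<Rightarrow> int" where
  "cycle_sign G vs = (\<Prod>i<length vs. sg_sign G (cycle_edge vs i))"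

definition negative_cycle_free :: "nat \<Rightarrow> 'a sgraph \<Rightarrow> bool" where
  "negative_cycle_free l G \<longleftrightarrow>
     \<not> (\<exists>vs. is_cycle G vs \<and> length vs = l \<and> cycle_sign G vs = -1)"

text \<open>
  For \<open>n \<ge> 3\<close>: the positive complete graph lives on \<open>{..<n - 2}\<close>, the triangle on
  \<open>{0, n - 2, n - 1}\<close>, and \<open>0\<close> is the identified vertex. The sign pattern chosen on the
  triangle is immaterial: switching at \<open>n - 2\<close> and \<open>n - 1\<close> gives all the others with
  negative product.
\<close>

definition C3neg_dot_K :: "nat \<Rightarrow> nat sgraph" where
  "C3neg_dot_K n =
     \<lparr>sg_verts = {..<n},
      sg_edges = {{u, v} | u v. u < n - 2 \<and> v < n - 2 \<and> u \<noteq> v}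
                 \<union> {{0, n - 2}, {0, n - 1}, {n - 2, n - 1}},
      sg_sign = (\<lambda>e. if e = {n - 2, n - 1} then -1 else 1)\<rparr>"

text \<open>The choice of enumeration in \<open>sg_eigenvalues\<close> is immaterial.\<close>

lemma eigenvalue_adj_matrix_iff:
  assumes d: "distinct vs" and V: "set vs = sg_verts G"
  shows "eigenvalue (adj_matrix G vs) x \<longleftrightarrow>
    (\<exists>f. (\<exists>v\<in>sg_verts G. f v \<noteq> 0) \<and>
         (\<forall>u\<in>sg_verts G. (\<Sum>v\<in>sg_verts G. adj_entry G u v * f v) = x * f u))"
proof -
  let ?n = "length vs" and ?A = "adj_matrix G vs"
  have carr: "?A \<in> carrier_mat ?n ?n" by (simp add: adj_matrix_def)
  have sum_V: "(\<Sum>v\<in>sg_verts G. g v) = (\<Sum>j<?n. g (vs ! j))" for g :: "'a \<Rightarrow> real"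
    using sum.reindex_bij_betw[OF bij_betw_nth[OF d refl refl], of g] V by simp
  have mult: "(?A *\<^sub>v w) $ i = (\<Sum>j<?n. adj_entry G (vs ! i) (vs ! j) * w $ j)"
    if "w \<in> carrier_vec ?n" "i < ?n" for w i
    using that by (simp add: adj_matrix_def scalar_prod_def atLeast0LessThan)
  show ?thesis
  proof
    assume "eigenvalue ?A x"
    then obtain w where w: "w \<in> carrier_vec ?n" "w \<noteq> 0\<^sub>v ?n" "?A *\<^sub>v w = x \<cdot>\<^sub>v w"
      using carr by (auto simp: eigenvalue_def eigenvector_def)
    define f where "f v = w $ (THE i. i < ?n \<and> vs ! i = v)" for v
    have f: "f (vs ! i) = w $ i" if "i < ?n" for i
    proof -
      have "(THE j. j < ?n \<and> vs ! j = vs ! i) = i"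
        using that d by (intro the_equality) (auto simp: nth_eq_iff_index_eq)
      then show ?thesis by (simp add: f_def)
    qed
    obtain i where i: "i < ?n" "w $ i \<noteq> 0"
    proof -
      have "\<exists>i<?n. w $ i \<noteq> 0"
      proof (rule ccontr)
        assume "\<not> ?thesis"
        then have "w = 0\<^sub>v ?n" using w(1) by (intro eq_vecI) auto
        with w(2) show False ..
      qed
      then show thesis using that by blast
    qed
    have "vs ! i \<in> sg_verts G" using i(1) V nth_mem by blast
    moreover have "f (vs ! i) \<noteq> 0" using i f by simp
    ultimately have "\<exists>v\<in>sg_verts G. f v \<noteq> 0" by blast
    moreover have "(\<Sum>v\<in>sg_verts G. adj_entry G u v * f v) = x * f u"
      if "u \<in> sg_verts G" for u
    proof -
      obtain i where i: "i < ?n" "u = vs ! i"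
        using \<open>u \<in> sg_verts G\<close> V by (metis in_set_conv_nth)
      have "(\<Sum>v\<in>sg_verts G. adj_entry G u v * f v) = (?A *\<^sub>v w) $ i"
        using i w(1) by (simp add: sum_V mult f)
      also have "\<dots> = x * f u" using i w by (simp add: f)
      finally show ?thesis .
    qed
    ultimately show "\<exists>f. (\<exists>v\<in>sg_verts G. f v \<noteq> 0) \<and>
         (\<forall>u\<in>sg_verts G. (\<Sum>v\<in>sg_verts G. adj_entry G u v * f v) = x * f u)" by blast
  next
    assume "\<exists>f. (\<exists>v\<in>sg_verts G. f v \<noteq> 0) \<and>
         (\<forall>u\<in>sg_verts G. (\<Sum>v\<in>sg_verts G. adj_entry G u v * f v) = x * f u)"
    then obtain f v where f: "v \<in> sg_verts G" "f v \<noteq> 0"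
      "\<And>u. u \<in> sg_verts G \<Longrightarrow> (\<Sum>v\<in>sg_verts G. adj_entry G u v * f v) = x * f u" by blast
    define w where "w = vec ?n (\<lambda>i. f (vs ! i))"
    have w: "w \<in> carrier_vec ?n" by (simp add: w_def)
    obtain i where i: "i < ?n" "v = vs ! i" using f(1) V by (metis in_set_conv_nth)
    have "w \<noteq> 0\<^sub>v ?n"
    proof
      assume "w = 0\<^sub>v ?n"
      then have "w $ i = 0" using i by simp
      then show False using i f(2) by (simp add: w_def)
    qed
    moreover have "?A *\<^sub>v w = x \<cdot>\<^sub>v w"
    proof (rule eq_vecI)
      fix i assume "i < dim_vec (x \<cdot>\<^sub>v w)"
      then have i: "i < ?n" by (simp add: w_def)
      have mem: "vs ! i \<in> sg_verts G" using V i nth_mem by blast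
      have wj: "w $ j = f (vs ! j)" if "j < ?n" for j using that by (simp add: w_def)
      have "(?A *\<^sub>v w) $ i = (\<Sum>j<?n. adj_entry G (vs ! i) (vs ! j) * f (vs ! j))"
        unfolding mult[OF w i] by (rule sum.cong) (simp_all add: wj)
      also have "\<dots> = x * f (vs ! i)"
        using f(3)[OF mem] unfolding sum_V .
      also have "\<dots> = (x \<cdot>\<^sub>v w) $ i" using i by (simp add: w_def)
      finally show "(?A *\<^sub>v w) $ i = (x \<cdot>\<^sub>v w) $ i" .
    qed (simp add: w_def adj_matrix_def)
    ultimately show "eigenvalue ?A x"
      using w carr unfolding eigenvalue_def eigenvector_def by (intro exI[of _ w]) simp
  qed
qed

lemma sg_eigenvalues_eq:
  assumes "distinct vs" and "set vs = sg_verts G"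
  shows "sg_eigenvalues G = {x. eigenvalue (adj_matrix G vs) x}"
proof -
  have "eigenvalue (adj_matrix G us) x = eigenvalue (adj_matrix G vs) x"
    if "distinct us" "set us = sg_verts G" for us x
    unfolding eigenvalue_adj_matrix_iff[OF that] eigenvalue_adj_matrix_iff[OF assms] ..
  then show ?thesis unfolding sg_eigenvalues_def using assms by blast
qed

end

theory Submission
  imports Defs "HOL-Analysis.Function_Topology"
begin

text \<open>
  Suppose the spectral radius \<open>r\<close> of \<open>G\<close> is at least that of \<open>C3neg_dot_K n\<close>, which exceeds
  \<open>n - 3\<close>. After switching and, if \<open>-r\<close> rather than \<open>r\<close> is an eigenvalue, negating all signs,
  \<open>r\<close> has an eigenfunction \<open>x\<close> with values in \<open>[0, 1]\<close> and maximum \<open>1\<close>. The eigenvalue equation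
  at the maximum gives \<open>\<Sum>(1 - x v) < 2\<close>, and every vertex \<open>u\<close> has at least \<open>(n - 3) x u\<close> positive
  neighbours. Hence at most two vertices are low (\<open>x < 1/3\<close>), at most seven fail \<open>x \<ge> 3/4\<close>, and
  any two vertices that are not low are joined by positive paths with any number of vertices from
  \<open>5\<close> to \<open>2 k + 1\<close>, avoiding two prescribed vertices.

  If the signs were negated, a cycle of \<open>2 k + 1\<close> positive edges would be a negative cycle of \<open>G\<close>.
  Otherwise, closing positive paths to cycles of length \<open>2 k + 1\<close> shows that every negative edge
  meets a low vertex and that each low vertex sees the others with a single sign. As \<open>G\<close> is
  unbalanced, there are two low vertices \<open>a\<close>, \<open>b\<close>, which after switching are joined by a negative
  edge and have a single further neighbour, the same for both. So \<open>G\<close> is, up to switching, a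
  subgraph of \<open>C3neg_dot_K n\<close> that lacks only edges between vertices where \<open>x\<close> is positive, and
  comparing Rayleigh quotients shows that it lacks none.
\<close>

section \<open>Quadratic forms and eigenfunctions\<close>

definition matrix_apply :: "'a set \<Rightarrow> ('a \<Rightarrow> 'a \<Rightarrow> real) \<Rightarrow> ('a \<Rightarrow> real) \<Rightarrow> 'a \<Rightarrow> real" where
  "matrix_apply V A f u = (\<Sum>v\<in>V. A u v * f v)"

definition quadratic_form :: "'a set \<Rightarrow> ('a \<Rightarrow> 'a \<Rightarrow> real) \<Rightarrow> ('a \<Rightarrow> real) \<Rightarrow> real" where
  "quadratic_form V A f = (\<Sum>u\<in>V. f u * matrix_apply V A f u)"

definition norm_sq :: "'a set \<Rightarrow> ('a \<Rightarrow> real) \<Rightarrow> real" where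
  "norm_sq V f = (\<Sum>u\<in>V. (f u)\<^sup>2)"

definition eigenfunction :: "'a set \<Rightarrow> ('a \<Rightarrow> 'a \<Rightarrow> real) \<Rightarrow> real \<Rightarrow> ('a \<Rightarrow> real) \<Rightarrow> bool" where
  "eigenfunction V A \<mu> f \<longleftrightarrow>
    (\<exists>v\<in>V. f v \<noteq> 0) \<and> (\<forall>u\<in>V. matrix_apply V A f u = \<mu> * f u)"

lemma matrix_apply_cong:
  "(\<And>v. v \<in> V \<Longrightarrow> f v = g v) \<Longrightarrow> matrix_apply V A f = matrix_apply V A g"
  by (simp add: matrix_apply_def fun_eq_iff)

lemma quadratic_form_cong:
  assumes "\<And>v. v \<in> V \<Longrightarrow> f v = g v"
  shows "quadratic_form V A f = quadratic_form V A g"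
  by (simp add: quadratic_form_def matrix_apply_cong[OF assms] assms)

lemma norm_sq_cong: "(\<And>v. v \<in> V \<Longrightarrow> f v = g v) \<Longrightarrow> norm_sq V f = norm_sq V g"
  by (simp add: norm_sq_def)

lemma eigenfunction_cong:
  assumes "\<And>v. v \<in> V \<Longrightarrow> f v = g v"
  shows "eigenfunction V A \<mu> f \<longleftrightarrow> eigenfunction V A \<mu> g"
  by (simp add: eigenfunction_def matrix_apply_cong[OF assms] assms)

lemma matrix_apply_scale: "matrix_apply V A (\<lambda>v. c * f v) u = c * matrix_apply V A f u"
  by (simp add: matrix_apply_def sum_distrib_left mult_ac)

lemma quadratic_form_scale: "quadratic_form V A (\<lambda>v. c * f v) = c\<^sup>2 * quadratic_form V A f"
  by (simp add: quadratic_form_def matrix_apply_scale sum_distrib_left power2_eq_square mult_ac)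

lemma norm_sq_scale: "norm_sq V (\<lambda>v. c * f v) = c\<^sup>2 * norm_sq V f"
  by (simp add: norm_sq_def power_mult_distrib sum_distrib_left)

lemma norm_sq_nonneg: "0 \<le> norm_sq V f"
  by (simp add: norm_sq_def sum_nonneg)

lemma norm_sq_eq_0_iff: "finite V \<Longrightarrow> norm_sq V f = 0 \<longleftrightarrow> (\<forall>v\<in>V. f v = 0)"
  by (simp add: norm_sq_def sum_nonneg_eq_0_iff)

lemma norm_sq_indicator:
  assumes "finite V" and "w \<in> V"
  shows "norm_sq V (\<lambda>v. if v = w then 1 else 0) = 1"
proof -
  have "norm_sq V (\<lambda>v. if v = w then 1 else 0) = (\<Sum>v\<in>V. if v = w then 1 else 0)"
    unfolding norm_sq_def by (intro sum.cong) auto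
  then show ?thesis using assms by simp
qed

lemma quadratic_form_eigenfunction:
  "eigenfunction V A \<mu> f \<Longrightarrow> quadratic_form V A f = \<mu> * norm_sq V f"
  by (simp add: eigenfunction_def quadratic_form_def norm_sq_def power2_eq_square
      sum_distrib_left mult_ac)

lemma compact_unit_sphere:
  assumes fin: "finite V"
  shows "compact {f. (\<forall>v. v \<notin> V \<longrightarrow> f v = 0) \<and> norm_sq V f = 1}"
proof -
  define cube where "cube = (\<Pi>\<^sub>E v\<in>UNIV. if v \<in> V then {-1..1} else {0::real})"
  have "compactin (product_topology (\<lambda>_. euclidean) UNIV) cube"
    unfolding cube_def by (subst compactin_PiE) auto
  then have "compact cube" by (simp add: euclidean_product_topology)
  moreover have "continuous_on UNIV (norm_sq V)"
    unfolding norm_sq_def by (intro continuous_intros continuous_on_product_coordinates)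
  then have "closed {f. norm_sq V f = 1}" by (intro closed_Collect_eq) auto
  ultimately have "compact (cube \<inter> {f. norm_sq V f = 1})" by (rule compact_Int_closed)
  moreover have "f \<in> cube \<longleftrightarrow> (\<forall>v. v \<notin> V \<longrightarrow> f v = 0)" if "norm_sq V f = 1" for f
  proof -
    have "(f v)\<^sup>2 \<le> 1" if "v \<in> V" for v
      using fin that \<open>norm_sq V f = 1\<close> member_le_sum[of v V "\<lambda>v. (f v)\<^sup>2"]
      by (simp add: norm_sq_def)
    then show ?thesis by (auto simp: cube_def abs_square_le_1 abs_le_iff PiE_iff)
  qed
  then have "cube \<inter> {f. norm_sq V f = 1} = {f. (\<forall>v. v \<notin> V \<longrightarrow> f v = 0) \<and> norm_sq V f = 1}"
    by blast
  ultimately show ?thesis by simp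
qed

lemma quadratic_form_le_if_unit_sphere:
  assumes fin: "finite V"
    and unit: "\<And>h. (\<forall>v. v \<notin> V \<longrightarrow> h v = 0) \<Longrightarrow> norm_sq V h = 1 \<Longrightarrow> quadratic_form V A h \<le> c"
  shows "quadratic_form V A g \<le> c * norm_sq V g"
proof (cases "norm_sq V g = 0")
  case True
  then have "quadratic_form V A g = 0"
    by (simp add: quadratic_form_def norm_sq_eq_0_iff[OF fin])
  then show ?thesis using True by simp
next
  case False
  then have pos: "0 < norm_sq V g" using norm_sq_nonneg[of V g] by simp
  define scale where "scale = 1 / sqrt (norm_sq V g)"
  have scale_sq: "scale\<^sup>2 = 1 / norm_sq V g" using pos by (simp add: scale_def power_divide)
  define h where "h v = (if v \<in> V then scale * g v else 0)" for v
  have "norm_sq V h = scale\<^sup>2 * norm_sq V g"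
    using norm_sq_cong[of V h "\<lambda>v. scale * g v"] by (simp add: h_def norm_sq_scale)
  then have "quadratic_form V A h \<le> c" using pos scale_sq by (intro unit) (simp_all add: h_def)
  moreover have "quadratic_form V A h = scale\<^sup>2 * quadratic_form V A g"
    using quadratic_form_cong[of V h "\<lambda>v. scale * g v"] by (simp add: h_def quadratic_form_scale)
  ultimately have "quadratic_form V A g / norm_sq V g \<le> c" using scale_sq by simp
  then show ?thesis using pos by (simp add: divide_le_eq)
qed

lemma rayleigh_quotient_attains_maximum:
  fixes A :: "'a \<Rightarrow> 'a \<Rightarrow> real"
  assumes fin: "finite V" and "V \<noteq> {}"
  obtains f where "norm_sq V f = 1"
    and "\<And>g. quadratic_form V A g \<le> quadratic_form V A f * norm_sq V g"
proof -
  define S where "S = {f. (\<forall>v. v \<notin> V \<longrightarrow> f v = 0) \<and> norm_sq V f = 1}"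
  obtain w where "w \<in> V" using \<open>V \<noteq> {}\<close> by blast
  then have "(\<lambda>v. if v = w then 1 else 0) \<in> S"
    using norm_sq_indicator[OF fin] by (auto simp: S_def)
  then have "S \<noteq> {}" by blast
  moreover have "compact S" unfolding S_def by (rule compact_unit_sphere[OF fin])
  moreover have "continuous_on UNIV (quadratic_form V A)"
    unfolding quadratic_form_def matrix_apply_def
    by (intro continuous_intros continuous_on_product_coordinates)
  then have "continuous_on S (quadratic_form V A)" by (rule continuous_on_subset) simp
  ultimately obtain f where f: "f \<in> S"
    and max: "\<And>g. g \<in> S \<Longrightarrow> quadratic_form V A g \<le> quadratic_form V A f"
    using continuous_attains_sup by metis
  have "quadratic_form V A g \<le> quadratic_form V A f * norm_sq V g" for g
    using max by (intro quadratic_form_le_if_unit_sphere[OF fin]) (simp add: S_def)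
  then show thesis using that[of f] f by (simp add: S_def)
qed

lemma quadratic_form_perturb:
  assumes fin: "finite V" and w: "w \<in> V" and sym: "\<And>u v. A u v = A v u"
  shows "quadratic_form V A (\<lambda>v. f v + (if v = w then t else 0))
    = quadratic_form V A f + 2 * t * matrix_apply V A f w + t\<^sup>2 * A w w"
proof -
  have delta: "(\<Sum>v\<in>V. (if v = w then t else 0) * g v) = t * g w" for g :: "'a \<Rightarrow> real"
    using fin w by (simp add: if_distrib[of "\<lambda>c. c * _"] cong: if_cong)
  have "matrix_apply V A (\<lambda>v. f v + (if v = w then t else 0)) u = matrix_apply V A f u + t * A u w"
    for u
    using delta[of "A u"] by (simp add: matrix_apply_def sum.distrib algebra_simps)
  moreover have "(\<Sum>u\<in>V. f u * A u w) = matrix_apply V A f w"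
    unfolding matrix_apply_def by (intro sum.cong refl) (simp add: sym[of _ w])
  then have "(\<Sum>u\<in>V. f u * (t * A u w)) = t * matrix_apply V A f w"
    by (simp add: sum_distrib_left[symmetric] mult.left_commute)
  ultimately show ?thesis
    using delta[of "\<lambda>u. matrix_apply V A f u + t * A u w"]
    by (simp add: quadratic_form_def distrib_left distrib_right sum.distrib power2_eq_square)
qed

lemma nonneg_quadratic_form_null_vector:
  assumes "finite V" and "w \<in> V" and "\<And>u v. A u v = A v u"
    and nonneg: "\<And>g. 0 \<le> quadratic_form V A g" and null: "quadratic_form V A f = 0"
  shows "matrix_apply V A f w = 0"
proof -
  define c where "c = matrix_apply V A f w"
  define q where "q = \<bar>A w w\<bar> + 1"
  have q: "0 < q" "A w w < q" by (simp_all add: q_def)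
  have "0 \<le> 2 * t * c + t\<^sup>2 * A w w" for t
    using nonneg[of "\<lambda>v. f v + (if v = w then t else 0)"] null
    by (simp add: quadratic_form_perturb[OF assms(1-3)] c_def)
  moreover have "t\<^sup>2 * A w w \<le> t\<^sup>2 * q" for t using q by (intro mult_left_mono) auto
  ultimately have "0 \<le> 2 * t * c + t\<^sup>2 * q" for t by (meson add_left_mono order_trans)
  from this[of "- c / q"] have "c\<^sup>2 \<le> 0" using q by (simp add: power2_eq_square field_simps)
  then show ?thesis by (simp add: c_def)
qed

lemma symmetric_top_eigenvalue:
  fixes A :: "'a \<Rightarrow> 'a \<Rightarrow> real"
  assumes fin: "finite V" and "V \<noteq> {}" and sym: "\<And>u v. A u v = A v u"
  obtains \<mu> f where "eigenfunction V A \<mu> f"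
    and "\<And>g. quadratic_form V A g \<le> \<mu> * norm_sq V g"
proof -
  obtain f where f: "norm_sq V f = 1"
    and max: "\<And>g. quadratic_form V A g \<le> quadratic_form V A f * norm_sq V g"
    by (rule rayleigh_quotient_attains_maximum[OF fin \<open>V \<noteq> {}\<close>]) blast
  define \<mu> where "\<mu> = quadratic_form V A f"
  define shifted where "shifted u v = (if u = v then \<mu> else 0) - A u v" for u v
  have apply_shifted: "matrix_apply V shifted g u = \<mu> * g u - matrix_apply V A g u"
    if "u \<in> V" for g u
    using fin that by (simp add: shifted_def matrix_apply_def left_diff_distrib sum_subtractf
        if_distrib[of "\<lambda>c. c * _"] cong: if_cong)
  have form_shifted: "quadratic_form V shifted g = \<mu> * norm_sq V g - quadratic_form V A g" for g
    by (simp add: quadratic_form_def apply_shifted norm_sq_def power2_eq_square sum_distrib_left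
        right_diff_distrib sum_subtractf mult_ac)
  have "matrix_apply V shifted f u = 0" if "u \<in> V" for u
  proof (rule nonneg_quadratic_form_null_vector[OF fin that])
    show "shifted u v = shifted v u" for u v using sym by (simp add: shifted_def)
    show "0 \<le> quadratic_form V shifted g" for g using max[of g] by (simp add: form_shifted \<mu>_def)
    show "quadratic_form V shifted f = 0" using f by (simp add: form_shifted \<mu>_def)
  qed
  then have "\<forall>u\<in>V. matrix_apply V A f u = \<mu> * f u" by (simp add: apply_shifted)
  moreover have "\<exists>v\<in>V. f v \<noteq> 0" using f norm_sq_eq_0_iff[OF fin, of f] by auto
  ultimately show thesis using that max by (simp add: eigenfunction_def \<mu>_def)
qed

lemma quadratic_form_strict_mono:
  assumes fin: "finite V"
    and "\<And>u v. u \<in> V \<Longrightarrow> v \<in> V \<Longrightarrow> A u v = B u v \<or> A u v < B u v \<and> 0 < f u \<and> 0 < f v"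
    and ab: "a \<in> V" "b \<in> V" "A a b \<noteq> B a b"
  shows "quadratic_form V A f < quadratic_form V B f"
proof -
  have le: "f u * (A u v * f v) \<le> f u * (B u v * f v)" if "u \<in> V" "v \<in> V" for u v
    using assms(2)[OF that] by auto
  have "f a * (A a b * f b) < f a * (B a b * f b)"
    using assms(2)[OF ab(1,2)] ab(3) by simp
  then have "(\<Sum>v\<in>V. f a * (A a v * f v)) < (\<Sum>v\<in>V. f a * (B a v * f v))"
    using le ab by (intro sum_strict_mono_ex1[OF fin]) auto
  moreover have "(\<Sum>v\<in>V. f u * (A u v * f v)) \<le> (\<Sum>v\<in>V. f u * (B u v * f v))" if "u \<in> V" for u
    using le that by (intro sum_mono) auto
  ultimately show ?thesis
    unfolding quadratic_form_def matrix_apply_def sum_distrib_left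
    using ab(1) by (intro sum_strict_mono_ex1[OF fin]) auto
qed

section \<open>Switching real matrices\<close>

definition sign_function :: "('a \<Rightarrow> real) \<Rightarrow> bool" where
  "sign_function t \<longleftrightarrow> (\<forall>v. t v = 1 \<or> t v = -1)"

definition switched :: "('a \<Rightarrow> real) \<Rightarrow> ('a \<Rightarrow> 'a \<Rightarrow> real) \<Rightarrow> 'a \<Rightarrow> 'a \<Rightarrow> real" where
  "switched t A u v = t u * A u v * t v"

lemma sign_function_cases:
  assumes "sign_function t"
  obtains "t v = 1" | "t v = -1"
  using assms unfolding sign_function_def by blast

lemma sign_function_square: "sign_function t \<Longrightarrow> t v * t v = 1"
  by (erule sign_function_cases[of _ v]) auto

lemma sign_function_mult: "sign_function s \<Longrightarrow> sign_function t \<Longrightarrow> sign_function (\<lambda>v. s v * t v)"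
  unfolding sign_function_def by (metis minus_mult_minus mult_1 mult_1_right)

lemma switched_switched: "switched s (switched t A) = switched (\<lambda>v. s v * t v) A"
  by (simp add: switched_def fun_eq_iff mult_ac)

lemma matrix_apply_reindex:
  assumes "bij_betw f V W" and "\<And>v. v \<in> V \<Longrightarrow> B (f u) (f v) = switched t A u v"
  shows "matrix_apply W B g (f u) = t u * matrix_apply V A (\<lambda>v. t v * g (f v)) u"
proof -
  have "matrix_apply W B g (f u) = (\<Sum>v\<in>V. B (f u) (f v) * g (f v))"
    unfolding matrix_apply_def by (rule sum.reindex_bij_betw[OF assms(1), symmetric])
  also have "\<dots> = (\<Sum>v\<in>V. t u * (A u v * (t v * g (f v))))"
    by (intro sum.cong refl) (simp add: assms(2) switched_def mult_ac)
  finally show ?thesis by (simp add: matrix_apply_def sum_distrib_left)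
qed

lemma quadratic_form_reindex:
  assumes "bij_betw f V W"
    and "\<And>u v. u \<in> V \<Longrightarrow> v \<in> V \<Longrightarrow> B (f u) (f v) = switched t A u v"
  shows "quadratic_form W B g = quadratic_form V A (\<lambda>v. t v * g (f v))"
proof -
  have "quadratic_form W B g = (\<Sum>u\<in>V. g (f u) * matrix_apply W B g (f u))"
    unfolding quadratic_form_def by (rule sum.reindex_bij_betw[OF assms(1), symmetric])
  also have "\<dots> = quadratic_form V A (\<lambda>v. t v * g (f v))"
    unfolding quadratic_form_def
    by (intro sum.cong refl)
      (simp add: matrix_apply_reindex[OF assms(1), of B _ t A] assms(2) mult_ac)
  finally show ?thesis .
qed

lemma norm_sq_reindex:
  assumes "bij_betw f V W" and t: "sign_function t"
  shows "norm_sq W g = norm_sq V (\<lambda>v. t v * g (f v))"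
proof -
  have "(t v * g (f v))\<^sup>2 = (g (f v))\<^sup>2" for v
    using sign_function_square[OF t, of v] by (simp add: power_mult_distrib power2_eq_square)
  then show ?thesis
    unfolding norm_sq_def by (simp add: sum.reindex_bij_betw[OF assms(1), symmetric])
qed

lemma eigenfunction_reindex:
  assumes f: "bij_betw f V W" and t: "sign_function t"
    and B: "\<And>u v. u \<in> V \<Longrightarrow> v \<in> V \<Longrightarrow> B (f u) (f v) = switched t A u v"
  shows "eigenfunction W B \<mu> g \<longleftrightarrow> eigenfunction V A \<mu> (\<lambda>v. t v * g (f v))"
proof -
  have "matrix_apply W B g (f u) = \<mu> * g (f u) \<longleftrightarrow>
      matrix_apply V A (\<lambda>v. t v * g (f v)) u = \<mu> * (t u * g (f u))" if "u \<in> V" for u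
    using matrix_apply_reindex[OF f, of B u t A g] B that
    by (cases rule: sign_function_cases[OF t, of u]) auto
  moreover have "t v * c \<noteq> 0 \<longleftrightarrow> c \<noteq> 0" for v c
    by (cases rule: sign_function_cases[OF t, of v]) auto
  ultimately show ?thesis
    unfolding eigenfunction_def bij_betw_imp_surj_on[OF f, symmetric] by simp
qed

lemma eigenfunction_switch_abs:
  assumes "eigenfunction V A \<mu> f"
  shows "eigenfunction V (switched (\<lambda>v. if f v < 0 then -1 else 1) A) \<mu> (\<lambda>v. \<bar>f v\<bar>)"
proof -
  let ?t = "\<lambda>v. if f v < 0 then -1 else 1 :: real"
  have "(\<lambda>v. ?t v * \<bar>f v\<bar>) = f" by auto
  then show ?thesis
    using eigenfunction_reindex[of id V V ?t "switched ?t A" A \<mu> "\<lambda>v. \<bar>f v\<bar>"] assms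
    by (simp add: sign_function_def)
qed

lemma eigenfunction_scale:
  "c \<noteq> 0 \<Longrightarrow> eigenfunction V A \<mu> (\<lambda>v. c * f v) \<longleftrightarrow> eigenfunction V A \<mu> f"
  by (simp add: eigenfunction_def matrix_apply_scale mult.left_commute)

lemma eigenfunction_uminus:
  "eigenfunction V (\<lambda>u v. - A u v) \<mu> f \<longleftrightarrow> eigenfunction V A (- \<mu>) f"
  by (auto simp: eigenfunction_def matrix_apply_def sum_negf minus_equation_iff)

lemma eigenfunction_normalize:
  assumes fin: "finite V" and f: "eigenfunction V A \<mu> f"
  obtains t x where "sign_function t" and "eigenfunction V (switched t A) \<mu> x"
    and "\<And>v. v \<in> V \<Longrightarrow> 0 \<le> x v \<and> x v \<le> 1" and "\<exists>v\<in>V. x v = 1"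
proof -
  define M where "M = Max ((\<lambda>v. \<bar>f v\<bar>) ` V)"
  have le_M: "\<bar>f v\<bar> \<le> M" if "v \<in> V" for v using fin that by (simp add: M_def)
  have "V \<noteq> {}" using f by (auto simp: eigenfunction_def)
  then have "M \<in> (\<lambda>v. \<bar>f v\<bar>) ` V" unfolding M_def using fin by (intro Max_in) auto
  then have attained: "\<exists>v\<in>V. \<bar>f v\<bar> = M" by auto
  obtain w where "w \<in> V" "f w \<noteq> 0" using f by (auto simp: eigenfunction_def)
  then have "0 < M" using le_M[of w] by linarith
  let ?t = "\<lambda>v. if f v < 0 then -1 else 1 :: real"
  show thesis
  proof (rule that[of ?t "\<lambda>v. 1 / M * \<bar>f v\<bar>"])
    show "eigenfunction V (switched ?t A) \<mu> (\<lambda>v. 1 / M * \<bar>f v\<bar>)"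
      using eigenfunction_switch_abs[OF f] \<open>0 < M\<close> by (subst eigenfunction_scale) auto
  qed (use \<open>0 < M\<close> le_M attained in \<open>auto simp: sign_function_def\<close>)
qed

definition balanced_matrix :: "'a set \<Rightarrow> ('a \<Rightarrow> 'a \<Rightarrow> real) \<Rightarrow> bool" where
  "balanced_matrix V A \<longleftrightarrow>
    (\<exists>t. sign_function t \<and> (\<forall>u\<in>V. \<forall>v\<in>V. 0 \<le> switched t A u v))"

lemma balanced_matrix_switchedD:
  assumes "sign_function t" and "balanced_matrix V (switched t A)"
  shows "balanced_matrix V A"
  using assms sign_function_mult unfolding balanced_matrix_def switched_switched by blast

fun walk_prod :: "('a \<Rightarrow> 'a \<Rightarrow> real) \<Rightarrow> 'a list \<Rightarrow> real" where
  "walk_prod A [] = 1"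
| "walk_prod A [v] = 1"
| "walk_prod A (u # v # ws) = A u v * walk_prod A (v # ws)"

definition cycle_prod :: "('a \<Rightarrow> 'a \<Rightarrow> real) \<Rightarrow> 'a list \<Rightarrow> real" where
  "cycle_prod A vs = walk_prod A (vs @ [hd vs])"

definition no_negative_cycle :: "nat \<Rightarrow> 'a set \<Rightarrow> ('a \<Rightarrow> 'a \<Rightarrow> real) \<Rightarrow> bool" where
  "no_negative_cycle l V A \<longleftrightarrow>
    (\<forall>vs. length vs = l \<longrightarrow> distinct vs \<longrightarrow> set vs \<subseteq> V \<longrightarrow> cycle_prod A vs \<noteq> -1)"

lemma walk_prod_append:
  "walk_prod A (us @ v # ws) = walk_prod A (us @ [v]) * walk_prod A (v # ws)"
proof (induction us)
  case (Cons u us)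
  then show ?case by (cases us) auto
qed simp

lemma walk_prod_eq_1: "successively (\<lambda>u v. A u v = 1) vs \<Longrightarrow> walk_prod A vs = 1"
  by (induction A vs rule: walk_prod.induct) auto

lemma walk_prod_eq_prod:
  "walk_prod A (u # ws) = (\<Prod>i<length ws. A ((u # ws) ! i) ((u # ws) ! Suc i))"
proof (induction ws arbitrary: u)
  case (Cons v ws)
  show ?case using Cons[of v] by (simp add: prod.lessThan_Suc_shift del: prod.lessThan_Suc)
qed simp

lemma walk_prod_switched:
  assumes t: "sign_function t"
  shows "walk_prod (switched t A) (u # ws) = t u * walk_prod A (u # ws) * t (last (u # ws))"
proof (induction ws arbitrary: u)
  case Nil
  show ?case using sign_function_square[OF t] by simp
next
  case (Cons v ws)
  have "walk_prod (switched t A) (u # v # ws)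
      = (t v * t v) * (t u * (A u v * walk_prod A (v # ws)) * t (last (v # ws)))"
    by (simp add: Cons[of v] switched_def mult_ac del: last.simps)
  then show ?case by (simp add: sign_function_square[OF t])
qed

lemma cycle_prod_eq_prod:
  "cycle_prod A vs = (\<Prod>i<length vs. A (vs ! i) (vs ! (Suc i mod length vs)))"
proof (cases vs)
  case (Cons u ws)
  have "cycle_prod A vs = (\<Prod>i<length vs. A ((vs @ [u]) ! i) ((vs @ [u]) ! Suc i))"
    using walk_prod_eq_prod[of A u "ws @ [u]"] by (simp add: cycle_prod_def Cons)
  also have "\<dots> = (\<Prod>i<length vs. A (vs ! i) (vs ! (Suc i mod length vs)))"
  proof (rule prod.cong)
    fix i assume "i \<in> {..<length vs}"
    then have "Suc i < length vs \<or> Suc i = length vs" by auto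
    then show "A ((vs @ [u]) ! i) ((vs @ [u]) ! Suc i) = A (vs ! i) (vs ! (Suc i mod length vs))"
      by (auto simp: nth_append nth_Cons' Cons)
  qed simp
  finally show ?thesis .
qed (simp add: cycle_prod_def)

lemma cycle_prod_switched:
  assumes "sign_function t"
  shows "cycle_prod (switched t A) vs = cycle_prod A vs"
proof (cases vs)
  case (Cons u ws)
  then show ?thesis
    using walk_prod_switched[OF assms, of A u "ws @ [u]"] sign_function_square[OF assms, of u]
    by (simp add: cycle_prod_def mult_ac)
qed (simp add: cycle_prod_def)

lemma cycle_prod_uminus: "cycle_prod (\<lambda>u v. - A u v) vs = (-1) ^ length vs * cycle_prod A vs"
  unfolding cycle_prod_eq_prod prod_uminus by simp

lemma cycle_prod_append_positive_path:
  assumes "successively (\<lambda>u v. A u v = 1) P" and "P \<noteq> []"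
  shows "cycle_prod A (P @ vs) = walk_prod A (last P # vs @ [hd P])"
proof -
  have "P @ vs @ [hd P] = butlast P @ last P # vs @ [hd P]" using assms(2) by simp
  then have "walk_prod A (P @ vs @ [hd P])
      = walk_prod A (butlast P @ [last P]) * walk_prod A (last P # vs @ [hd P])"
    using walk_prod_append by metis
  then show ?thesis using assms by (simp add: cycle_prod_def walk_prod_eq_1)
qed

lemma no_negative_cycle_switched:
  "sign_function t \<Longrightarrow> no_negative_cycle l V (switched t A) \<longleftrightarrow> no_negative_cycle l V A"
  by (simp add: no_negative_cycle_def cycle_prod_switched)

section \<open>Signed graphs and their adjacency functions\<close>

locale signed_matrix =
  fixes V :: "'a set" and A :: "'a \<Rightarrow> 'a \<Rightarrow> real"
  assumes finite_V: "finite V"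
    and entries: "A u v \<in> {-1, 0, 1}"
    and sym: "A u v = A v u"
    and diag: "A u u = 0"
begin

lemma signed_matrix_switched:
  assumes t: "sign_function t"
  shows "signed_matrix V (switched t A)"
proof
  show "switched t A u v \<in> {-1, 0, 1}" for u v
    using entries[of u v] by (cases rule: sign_function_cases[OF t, of u];
        cases rule: sign_function_cases[OF t, of v]) (auto simp: switched_def)
qed (auto simp: finite_V diag switched_def sym mult_ac)

lemma signed_matrix_uminus: "signed_matrix V (\<lambda>u v. - A u v)"
proof
  show "- A u v \<in> {-1, 0, 1}" for u v using entries[of u v] by auto
  show "- A u v = - A v u" for u v using sym[of u v] by simp
qed (simp_all add: finite_V diag)

lemma balanced_matrix_if_nonpos_row:
  assumes "\<And>v. v \<in> V \<Longrightarrow> A a v \<le> 0"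
    and "\<And>u v. u \<in> V - {a} \<Longrightarrow> v \<in> V - {a} \<Longrightarrow> 0 \<le> A u v"
  shows "balanced_matrix V A"
proof -
  define s where "s v = (if v = a then -1 else 1 :: real)" for v
  have "0 \<le> switched s A u v" if "u \<in> V" "v \<in> V" for u v
    using assms(1)[of u] assms(1)[of v] assms(2)[of u v] that diag[of a] sym[of u a]
    by (cases "u = a"; cases "v = a") (auto simp: switched_def s_def)
  moreover have "sign_function s" by (simp add: sign_function_def s_def)
  ultimately show ?thesis unfolding balanced_matrix_def by blast
qed

end

lemma adj_entry_sym: "adj_entry G u v = adj_entry G v u"
  by (simp add: adj_entry_def insert_commute)

lemma signed_matrix_adj_entry:
  assumes "signed_graph G"
  shows "signed_matrix (sg_verts G) (adj_entry G)"
  using assms by unfold_locales (auto simp: signed_graph_def adj_entry_def insert_commute)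

lemma sg_edgeE:
  assumes "signed_graph G" and "e \<in> sg_edges G"
  obtains u v where "e = {u, v}" "u \<noteq> v" "u \<in> sg_verts G" "v \<in> sg_verts G"
proof -
  have "card e = 2" "e \<subseteq> sg_verts G" using assms by (simp_all add: signed_graph_def)
  then show thesis using that by (auto simp: card_2_iff)
qed

lemma ball_sg_edges_iff:
  assumes "signed_graph G"
  shows "(\<forall>e\<in>sg_edges G. P e) \<longleftrightarrow>
    (\<forall>u\<in>sg_verts G. \<forall>v\<in>sg_verts G. {u, v} \<in> sg_edges G \<longrightarrow> P {u, v})"
  using sg_edgeE[OF assms] by metis

lemma adj_entry_eq_iff:
  assumes "signed_graph G" and "signed_graph H"
  shows "adj_entry H i j = adj_entry G u v \<longleftrightarrow>
    ({i, j} \<in> sg_edges H \<longleftrightarrow> {u, v} \<in> sg_edges G) \<and>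
    ({u, v} \<in> sg_edges G \<longrightarrow> sg_sign H {i, j} = sg_sign G {u, v})"
proof -
  have "sg_sign G {u, v} \<noteq> 0" if "{u, v} \<in> sg_edges G"
    using assms(1) that by (force simp: signed_graph_def)
  moreover have "sg_sign H {i, j} \<noteq> 0" if "{i, j} \<in> sg_edges H"
    using assms(2) that by (force simp: signed_graph_def)
  ultimately show ?thesis by (auto simp: adj_entry_def)
qed

lemma sg_edges_eq_image_iff:
  assumes G: "signed_graph G" and H: "signed_graph H"
    and f: "bij_betw f (sg_verts G) (sg_verts H)"
  shows "sg_edges H = (\<lambda>e. f ` e) ` sg_edges G \<longleftrightarrow>
    (\<forall>u\<in>sg_verts G. \<forall>v\<in>sg_verts G. {f u, f v} \<in> sg_edges H \<longleftrightarrow> {u, v} \<in> sg_edges G)"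
    (is "?image \<longleftrightarrow> ?pointwise")
proof
  assume image: ?image
  show ?pointwise
  proof (intro ballI)
    fix u v assume uv: "u \<in> sg_verts G" "v \<in> sg_verts G"
    have "f ` {u, v} \<in> (\<lambda>e. f ` e) ` sg_edges G \<longleftrightarrow> {u, v} \<in> sg_edges G"
      using uv G bij_betw_imp_inj_on[OF f]
      by (intro inj_on_image_mem_iff[OF inj_on_image[of f "Pow (sg_verts G)"]])
        (auto simp: signed_graph_def)
    then show "{f u, f v} \<in> sg_edges H \<longleftrightarrow> {u, v} \<in> sg_edges G" by (simp add: image)
  qed
next
  assume pointwise: ?pointwise
  have "e \<in> (\<lambda>e. f ` e) ` sg_edges G" if "e \<in> sg_edges H" for e
  proof -
    obtain i j where "e = {i, j}" "i \<in> sg_verts H" "j \<in> sg_verts H"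
      using sg_edgeE[OF H \<open>e \<in> sg_edges H\<close>] by metis
    moreover from this obtain u v where "u \<in> sg_verts G" "v \<in> sg_verts G" "i = f u" "j = f v"
      using bij_betw_imp_surj_on[OF f] by blast
    ultimately have "{u, v} \<in> sg_edges G" "e = f ` {u, v}" using that pointwise by auto
    then show ?thesis by blast
  qed
  moreover have "\<forall>e\<in>sg_edges G. f ` e \<in> sg_edges H"
    unfolding ball_sg_edges_iff[OF G] using pointwise by simp
  ultimately show ?image by blast
qed

lemma sg_isomorphic_iff:
  assumes G: "signed_graph G" and H: "signed_graph H"
  shows "sg_isomorphic G H \<longleftrightarrow>
    (\<exists>f. bij_betw f (sg_verts G) (sg_verts H) \<and>
      (\<forall>u\<in>sg_verts G. \<forall>v\<in>sg_verts G. adj_entry H (f u) (f v) = adj_entry G u v))"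
proof -
  have "sg_edges H = (\<lambda>e. f ` e) ` sg_edges G \<and>
      (\<forall>e\<in>sg_edges G. sg_sign H (f ` e) = sg_sign G e) \<longleftrightarrow>
      (\<forall>u\<in>sg_verts G. \<forall>v\<in>sg_verts G. adj_entry H (f u) (f v) = adj_entry G u v)"
    if "bij_betw f (sg_verts G) (sg_verts H)" for f
    unfolding sg_edges_eq_image_iff[OF G H that] ball_sg_edges_iff[OF G] adj_entry_eq_iff[OF G H]
    by (simp add: ball_conj_distrib)
  then show ?thesis unfolding sg_isomorphic_def by (intro ex_cong1 conj_cong) simp_all
qed

definition switching_signs :: "'a set \<Rightarrow> 'a \<Rightarrow> real" where
  "switching_signs U v = (if v \<in> U then -1 else 1)"

lemma sign_function_switching_signs: "sign_function (switching_signs U)"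
  by (simp add: sign_function_def switching_signs_def)

lemma sign_function_obtain_switching_set:
  assumes "sign_function t"
  obtains U where "U \<subseteq> V" and "\<And>v. v \<in> V \<Longrightarrow> switching_signs U v = t v"
proof (rule that[of "{v \<in> V. t v = -1}"])
  show "switching_signs {v \<in> V. t v = -1} v = t v" if "v \<in> V" for v
    using that by (cases rule: sign_function_cases[OF assms, of v]) (auto simp: switching_signs_def)
qed blast

lemma switch_simps [simp]:
  "sg_verts (switch U G) = sg_verts G"
  "sg_edges (switch U G) = sg_edges G"
  by (simp_all add: switch_def)

lemma sg_sign_switch:
  "sg_sign (switch U G) e =
    (if \<exists>u\<in>U. \<exists>v\<in>sg_verts G - U. e = {u, v} then - sg_sign G e else sg_sign G e)"
  by (simp add: switch_def)

lemma signed_graph_switch: "signed_graph G \<Longrightarrow> signed_graph (switch U G)"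
  unfolding signed_graph_def by (simp add: switch_def) force

lemma adj_entry_switch:
  assumes "u \<in> sg_verts G" and "v \<in> sg_verts G"
  shows "adj_entry (switch U G) u v = switched (switching_signs U) (adj_entry G) u v"
proof -
  have "(\<exists>u'\<in>U. \<exists>v'\<in>sg_verts G - U. {u, v} = {u', v'}) \<longleftrightarrow> (u \<in> U) \<noteq> (v \<in> U)"
    using assms by (auto simp: doubleton_eq_iff)
  then have "sg_sign (switch U G) {u, v} =
      (if (u \<in> U) \<noteq> (v \<in> U) then - sg_sign G {u, v} else sg_sign G {u, v})"
    by (simp only: sg_sign_switch)
  then show ?thesis by (simp add: adj_entry_def switched_def switching_signs_def)
qed

lemma switching_equivalent_iff:
  assumes G: "signed_graph G" and H: "signed_graph H"
  shows "switching_equivalent G H \<longleftrightarrow>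
    (\<exists>t f. sign_function t \<and> bij_betw f (sg_verts G) (sg_verts H) \<and>
      (\<forall>u\<in>sg_verts G. \<forall>v\<in>sg_verts G.
        adj_entry H (f u) (f v) = switched t (adj_entry G) u v))"
    (is "_ \<longleftrightarrow> (\<exists>t f. sign_function t \<and> ?iso t f)")
proof -
  have "sg_isomorphic (switch U G) H \<longleftrightarrow> (\<exists>f. ?iso (switching_signs U) f)" for U
    using sg_isomorphic_iff[OF signed_graph_switch[OF G] H] by (simp add: adj_entry_switch)
  then have "switching_equivalent G H \<longleftrightarrow>
      (\<exists>U\<subseteq>sg_verts G. \<exists>f. ?iso (switching_signs U) f)"
    by (simp add: switching_equivalent_def)
  also have "\<dots> \<longleftrightarrow> (\<exists>t f. sign_function t \<and> ?iso t f)"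
  proof (intro iffI)
    assume "\<exists>t f. sign_function t \<and> ?iso t f"
    then obtain t f where t: "sign_function t" and iso: "?iso t f" by blast
    obtain U where U: "U \<subseteq> sg_verts G" "\<And>v. v \<in> sg_verts G \<Longrightarrow> switching_signs U v = t v"
      using sign_function_obtain_switching_set[OF t] by blast
    have "?iso (switching_signs U) f" using iso by (simp add: switched_def U(2))
    then show "\<exists>U\<subseteq>sg_verts G. \<exists>f. ?iso (switching_signs U) f" using U(1) by blast
  qed (use sign_function_switching_signs in blast)
  finally show ?thesis .
qed

lemma balanced_if_balanced_matrix:
  assumes G: "signed_graph G" and "balanced_matrix (sg_verts G) (adj_entry G)"
  shows "balanced G"
proof -
  obtain t where t: "sign_function t"
    and nonneg: "\<forall>u\<in>sg_verts G. \<forall>v\<in>sg_verts G. 0 \<le> switched t (adj_entry G) u v"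
    using assms(2) unfolding balanced_matrix_def by blast
  obtain U where U: "\<And>v. v \<in> sg_verts G \<Longrightarrow> switching_signs U v = t v"
    using sign_function_obtain_switching_set[OF t, of "sg_verts G"] by metis
  define H where "H = switch U G"
  have H: "signed_graph H" unfolding H_def using G by (rule signed_graph_switch)
  have adj: "adj_entry H u v = switched t (adj_entry G) u v"
    if "u \<in> sg_verts G" "v \<in> sg_verts G" for u v
    using adj_entry_switch[OF that] that by (simp add: H_def switched_def U)
  then have "switching_equivalent G H"
    unfolding switching_equivalent_iff[OF G H] using t
    by (intro exI[of _ t] exI[of _ id]) (simp add: H_def)
  moreover have "\<forall>e\<in>sg_edges H. sg_sign H e = 1"
    unfolding ball_sg_edges_iff[OF H]
  proof (intro ballI impI)
    fix u v assume uv: "u \<in> sg_verts H" "v \<in> sg_verts H" "{u, v} \<in> sg_edges H"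
    then have "0 \<le> adj_entry H u v" using adj nonneg by (simp add: H_def)
    then show "sg_sign H {u, v} = 1" using H uv(3) by (auto simp: adj_entry_def signed_graph_def)
  qed
  ultimately show ?thesis using H unfolding balanced_def by blast
qed

lemma no_negative_cycle_adj_entry:
  assumes G: "signed_graph G" and free: "negative_cycle_free l G" and "3 \<le> l"
  shows "no_negative_cycle l (sg_verts G) (adj_entry G)"
  unfolding no_negative_cycle_def
proof (intro allI impI notI)
  fix vs assume vs: "length vs = l" "distinct vs" "set vs \<subseteq> sg_verts G"
    and neg: "cycle_prod (adj_entry G) vs = -1"
  have edge: "cycle_edge vs i \<in> sg_edges G" if "i < length vs" for i
  proof (rule ccontr)
    assume "cycle_edge vs i \<notin> sg_edges G"
    then have "adj_entry G (vs ! i) (vs ! (Suc i mod length vs)) = 0"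
      by (simp add: adj_entry_def cycle_edge_def)
    then have "cycle_prod (adj_entry G) vs = 0" using that by (auto simp: cycle_prod_eq_prod)
    then show False using neg by simp
  qed
  then have "cycle_prod (adj_entry G) vs = of_int (cycle_sign G vs)"
    unfolding cycle_prod_eq_prod cycle_sign_def of_int_prod
    by (intro prod.cong refl) (simp add: adj_entry_def cycle_edge_def)
  then have "cycle_sign G vs = -1" using neg by linarith
  moreover have "is_cycle G vs" using vs edge \<open>3 \<le> l\<close> by (simp add: is_cycle_def)
  ultimately show False using free vs unfolding negative_cycle_free_def by blast
qed

section \<open>The spectral radius\<close>

lemma sg_eigenvalues_iff:
  assumes "finite (sg_verts G)"
  shows "\<mu> \<in> sg_eigenvalues G \<longleftrightarrow> (\<exists>f. eigenfunction (sg_verts G) (adj_entry G) \<mu> f)"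
proof -
  obtain vs where "distinct vs" "set vs = sg_verts G"
    using finite_distinct_list[OF assms] by blast
  then show ?thesis
    by (simp add: sg_eigenvalues_eq eigenvalue_adj_matrix_iff eigenfunction_def matrix_apply_def)
qed

lemma finite_sg_eigenvalues:
  assumes "finite (sg_verts G)"
  shows "finite (sg_eigenvalues G)"
proof -
  obtain vs where vs: "distinct vs" "set vs = sg_verts G"
    using finite_distinct_list[OF assms] by blast
  have carrier: "adj_matrix G vs \<in> carrier_mat (length vs) (length vs)"
    by (simp add: adj_matrix_def)
  have "char_poly (adj_matrix G vs) \<noteq> 0" using degree_monic_char_poly[OF carrier] by auto
  then show ?thesis
    by (simp add: sg_eigenvalues_eq[OF vs] eigenvalue_root_char_poly[OF carrier] poly_roots_finite)
qed

lemma ex_sg_eigenvalue_bounding_quadratic_form: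
  assumes fin: "finite (sg_verts G)" and "sg_verts G \<noteq> {}"
  shows "\<exists>\<mu>\<in>sg_eigenvalues G. \<forall>g.
    quadratic_form (sg_verts G) (adj_entry G) g \<le> \<mu> * norm_sq (sg_verts G) g"
proof -
  obtain \<mu> f where "eigenfunction (sg_verts G) (adj_entry G) \<mu> f"
    and "\<And>g. quadratic_form (sg_verts G) (adj_entry G) g \<le> \<mu> * norm_sq (sg_verts G) g"
    by (rule symmetric_top_eigenvalue[OF assms, of "adj_entry G", OF adj_entry_sym]) blast
  then show ?thesis using sg_eigenvalues_iff[OF fin] by blast
qed

lemma rayleigh_le_sg_spectral_radius:
  assumes fin: "finite (sg_verts G)" and "sg_verts G \<noteq> {}"
  shows "quadratic_form (sg_verts G) (adj_entry G) g
    \<le> sg_spectral_radius G * norm_sq (sg_verts G) g"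
proof -
  obtain \<mu> where \<mu>: "\<mu> \<in> sg_eigenvalues G"
    and bound: "quadratic_form (sg_verts G) (adj_entry G) g \<le> \<mu> * norm_sq (sg_verts G) g"
    using ex_sg_eigenvalue_bounding_quadratic_form[OF assms] by blast
  have "\<mu> \<le> sg_spectral_radius G"
    using \<mu> finite_sg_eigenvalues[OF fin] by (simp add: sg_spectral_radius_def le_max_iff_disj)
  then show ?thesis using bound mult_right_mono[OF _ norm_sq_nonneg] order_trans by blast
qed

lemma sg_spectral_radius_eigenfunction:
  assumes fin: "finite (sg_verts G)" and "sg_verts G \<noteq> {}"
  shows "\<exists>f. eigenfunction (sg_verts G) (adj_entry G) (sg_spectral_radius G) f \<or>
    eigenfunction (sg_verts G) (\<lambda>u v. - adj_entry G u v) (sg_spectral_radius G) f"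
proof -
  have "sg_eigenvalues G \<noteq> {}"
    using ex_sg_eigenvalue_bounding_quadratic_form[OF assms] by blast
  then have "Max (sg_eigenvalues G) \<in> sg_eigenvalues G" "Min (sg_eigenvalues G) \<in> sg_eigenvalues G"
    using finite_sg_eigenvalues[OF fin] by simp_all
  then have "sg_spectral_radius G \<in> sg_eigenvalues G \<or> - sg_spectral_radius G \<in> sg_eigenvalues G"
    by (simp add: sg_spectral_radius_def max_def)
  then show ?thesis by (auto simp: sg_eigenvalues_iff[OF fin] eigenfunction_uminus)
qed

lemma sg_spectral_radius_switching_equivalent:
  assumes G: "signed_graph G" and H: "signed_graph H" and equiv: "switching_equivalent G H"
  shows "sg_spectral_radius G = sg_spectral_radius H"
proof -
  obtain t f where t: "sign_function t" and f: "bij_betw f (sg_verts G) (sg_verts H)"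
    and adj: "\<And>u v. u \<in> sg_verts G \<Longrightarrow> v \<in> sg_verts G \<Longrightarrow>
      adj_entry H (f u) (f v) = switched t (adj_entry G) u v"
    using equiv unfolding switching_equivalent_iff[OF G H] by blast
  have fin: "finite (sg_verts G)" "finite (sg_verts H)"
    using G H by (simp_all add: signed_graph_def)
  note transport = eigenfunction_reindex[OF f t, of "adj_entry H", OF adj]
  have "\<mu> \<in> sg_eigenvalues G \<longleftrightarrow> \<mu> \<in> sg_eigenvalues H" for \<mu>
  proof
    assume "\<mu> \<in> sg_eigenvalues G"
    then obtain h where h: "eigenfunction (sg_verts G) (adj_entry G) \<mu> h"
      using sg_eigenvalues_iff[OF fin(1)] by blast
    define g where "g i = t (inv_into (sg_verts G) f i) * h (inv_into (sg_verts G) f i)" for i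
    have "t v * g (f v) = (t v * t v) * h v" if "v \<in> sg_verts G" for v
      using bij_betw_inv_into_left[OF f that] by (simp add: g_def)
    then have "t v * g (f v) = h v" if "v \<in> sg_verts G" for v
      using that by (simp add: sign_function_square[OF t])
    then have "eigenfunction (sg_verts G) (adj_entry G) \<mu> (\<lambda>v. t v * g (f v))"
      using h eigenfunction_cong[of "sg_verts G" "\<lambda>v. t v * g (f v)" h] by simp
    then have "eigenfunction (sg_verts H) (adj_entry H) \<mu> g" by (simp only: transport)
    then show "\<mu> \<in> sg_eigenvalues H" using sg_eigenvalues_iff[OF fin(2)] by blast
  next
    assume "\<mu> \<in> sg_eigenvalues H"
    then obtain g where "eigenfunction (sg_verts H) (adj_entry H) \<mu> g"
      using sg_eigenvalues_iff[OF fin(2)] by blast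
    then have "eigenfunction (sg_verts G) (adj_entry G) \<mu> (\<lambda>v. t v * g (f v))"
      by (simp only: transport)
    then show "\<mu> \<in> sg_eigenvalues G" using sg_eigenvalues_iff[OF fin(1)] by blast
  qed
  then have "sg_eigenvalues G = sg_eigenvalues H" by blast
  then show ?thesis by (simp add: sg_spectral_radius_def)
qed

section \<open>The extremal graph\<close>

text \<open>
  The adjacency function of \<open>C\<^sub>3\<^sup>- \<cdot> K\<^bsub>n-2\<^esub>\<close> on any vertex set: the clique is the complement of
  \<open>{a, b}\<close>, and \<open>w\<close> is the vertex it shares with the triangle.
\<close>

definition triangle_clique_entry :: "'a \<Rightarrow> 'a \<Rightarrow> 'a \<Rightarrow> 'a \<Rightarrow> 'a \<Rightarrow> real" where
  "triangle_clique_entry a b w u v =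
    (if u = v then 0
     else if u \<notin> {a, b} \<and> v \<notin> {a, b} then 1
     else if {u, v} = {a, b} then -1
     else if w \<in> {u, v} then 1 else 0)"

lemma triangle_clique_entry_sym:
  "triangle_clique_entry a b w u v = triangle_clique_entry a b w v u"
  by (auto simp: triangle_clique_entry_def insert_commute)

lemma triangle_clique_entry_inj_on:
  assumes f: "inj_on f V" and "{a, b, w, u, v} \<subseteq> V"
  shows "triangle_clique_entry (f a) (f b) (f w) (f u) (f v) = triangle_clique_entry a b w u v"
proof -
  have "f p = f q \<longleftrightarrow> p = q" if "p \<in> {a, b, w, u, v}" "q \<in> {a, b, w, u, v}" for p q
    using inj_on_eq_iff[OF f] assms(2) that by blast
  then show ?thesis by (simp add: triangle_clique_entry_def doubleton_eq_iff)
qed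

text \<open>
  The values of \<open>g\<close> are chosen to make the eigenvalue equation for \<open>m - 1\<close> exact away from \<open>w\<close>;
  the surplus at \<open>w\<close> puts the spectral radius above \<open>m - 1\<close>.
\<close>

lemma matrix_apply_triangle_clique:
  fixes V :: "'a set"
  defines "m \<equiv> real (card V) - 2"
  assumes fin: "finite V" and abw: "distinct [a, b, w]" "{a, b, w} \<subseteq> V" and u: "u \<in> V"
  defines "g \<equiv> \<lambda>v. if v \<in> {a, b} then 1 else m"
  shows "matrix_apply V (triangle_clique_entry a b w) g u
    = (m - 1) * g u + (if u = w then 2 else 0)"
proof -
  let ?E = "triangle_clique_entry a b w"
  define K where "K = V - {a, b}"
  have K: "finite K" "w \<in> K" using fin abw by (auto simp: K_def)
  have "card K = card V - 2" "2 \<le> card V"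
    using card_Diff_subset[of "{a, b}" V] card_mono[OF fin, of "{a, b}"] abw
    by (simp_all add: K_def)
  then have card_K: "real (card K) = m" by (simp add: m_def)
  have "V = insert a (insert b K)" "a \<notin> insert b K" "b \<notin> K" using abw by (auto simp: K_def)
  then have split: "matrix_apply V ?E g u = (\<Sum>v\<in>K. ?E u v * m) + ?E u a + ?E u b"
    using K(1) by (simp add: matrix_apply_def g_def) (auto intro!: sum.cong)
  show ?thesis
  proof (cases "u \<in> K")
    case True
    then have "(\<Sum>v\<in>K. ?E u v * m) = (\<Sum>v\<in>K. m - (if u = v then m else 0))"
      by (intro sum.cong) (auto simp: triangle_clique_entry_def K_def)
    also have "\<dots> = (m - 1) * m" using True K(1) card_K by (simp add: sum_subtractf algebra_simps)
    finally show ?thesis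
      using True abw split by (auto simp: triangle_clique_entry_def K_def g_def doubleton_eq_iff)
  next
    case False
    then have "u = a \<or> u = b" using u by (auto simp: K_def)
    then have "(\<Sum>v\<in>K. ?E u v * m) = (\<Sum>v\<in>K. if v = w then m else 0)"
      using abw by (intro sum.cong) (auto simp: triangle_clique_entry_def K_def doubleton_eq_iff)
    also have "\<dots> = m" using K by simp
    finally show ?thesis
      using \<open>u = a \<or> u = b\<close> abw split
      by (auto simp: triangle_clique_entry_def g_def doubleton_eq_iff)
  qed
qed

lemma ex_quadratic_form_triangle_clique_gt:
  fixes V :: "'a set"
  assumes fin: "finite V" and abw: "distinct [a, b, w]" "{a, b, w} \<subseteq> V"
  shows "\<exists>g. (real (card V) - 3) * norm_sq V g < quadratic_form V (triangle_clique_entry a b w) g"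
proof -
  define m where "m = real (card V) - 2"
  define g where "g v = (if v \<in> {a, b} then 1 else m)" for v
  have "card {a, b, w} \<le> card V" by (rule card_mono[OF fin abw(2)])
  then have "0 < m" using abw(1) by (simp add: m_def)
  have "quadratic_form V (triangle_clique_entry a b w) g
      = (\<Sum>u\<in>V. g u * ((m - 1) * g u + (if u = w then 2 else 0)))"
    unfolding quadratic_form_def m_def g_def
    using matrix_apply_triangle_clique[OF fin abw] by (intro sum.cong refl) simp
  also have "\<dots> = (m - 1) * norm_sq V g + (\<Sum>u\<in>V. if u = w then 2 * g w else 0)"
    unfolding norm_sq_def sum_distrib_left sum.distrib[symmetric]
    by (intro sum.cong) (auto simp: power2_eq_square algebra_simps)
  also have "\<dots> = (m - 1) * norm_sq V g + 2 * m" using abw fin by (auto simp: g_def)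
  finally show ?thesis using \<open>0 < m\<close> by (intro exI[of _ g]) (simp add: m_def)
qed

lemma bij_betw_extend:
  assumes "finite V" "finite W" "card V = card W" and S: "S \<subseteq> V" "inj_on g S" "g ` S \<subseteq> W"
  obtains f where "bij_betw f V W" and "\<And>v. v \<in> S \<Longrightarrow> f v = g v"
proof -
  have "card (V - S) = card (W - g ` S)"
    using assms by (simp add: card_Diff_subset card_image finite_subset)
  then obtain h where h: "bij_betw h (V - S) (W - g ` S)"
    using assms finite_same_card_bij[of "V - S" "W - g ` S"] by auto
  define f where "f v = (if v \<in> S then g v else h v)" for v
  have "bij_betw f S (g ` S)"
    using S(2) by (subst bij_betw_cong[of S f g]) (auto simp: f_def bij_betw_def)
  moreover have "bij_betw f (V - S) (W - g ` S)"
    using h by (subst bij_betw_cong[of "V - S" f h]) (auto simp: f_def)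
  ultimately have "bij_betw f (S \<union> (V - S)) (g ` S \<union> (W - g ` S))"
    by (rule bij_betw_combine) blast
  moreover have "S \<union> (V - S) = V" "g ` S \<union> (W - g ` S) = W" using S by auto
  ultimately show thesis using that[of f] by (simp add: f_def)
qed

lemma sg_verts_C3neg_dot_K [simp]: "sg_verts (C3neg_dot_K n) = {..<n}"
  by (simp add: C3neg_dot_K_def)

lemma signed_graph_C3neg_dot_K:
  assumes "3 \<le> n"
  shows "signed_graph (C3neg_dot_K n)"
  using assms by (auto simp: signed_graph_def C3neg_dot_K_def)

lemma adj_entry_C3neg_dot_K:
  assumes "3 \<le> n" "i < n" "j < n"
  shows "adj_entry (C3neg_dot_K n) i j = triangle_clique_entry (n - 2) (n - 1) 0 i j"
proof -
  obtain m where n: "n = Suc (Suc m)" using assms(1) that[of "n - 2"] by simp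
  have "adj_entry (C3neg_dot_K n) i j =
    (if i < m \<and> j < m \<and> i \<noteq> j \<or> {i, j} = {0, m} \<or> {i, j} = {0, Suc m} \<or> {i, j} = {m, Suc m}
     then if {i, j} = {m, Suc m} then -1 else 1 else 0)"
  proof -
    have "{i, j} \<in> {{u, v} | u v. u < m \<and> v < m \<and> u \<noteq> v} \<longleftrightarrow> i < m \<and> j < m \<and> i \<noteq> j"
      by (auto simp: doubleton_eq_iff)
    then show ?thesis by (simp add: adj_entry_def C3neg_dot_K_def n disj_ac)
  qed
  also have "\<dots> = triangle_clique_entry (n - 2) (n - 1) 0 i j"
    using assms by (auto simp: triangle_clique_entry_def doubleton_eq_iff n)
  finally show ?thesis .
qed

lemma C3neg_dot_K_labelling:
  assumes "finite V" and abw: "distinct [a, b, w]" "{a, b, w} \<subseteq> V"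
  obtains f where "bij_betw f V {..<card V}" and "\<And>u v. u \<in> V \<Longrightarrow> v \<in> V \<Longrightarrow>
    adj_entry (C3neg_dot_K (card V)) (f u) (f v) = triangle_clique_entry a b w u v"
proof -
  define g where "g v = (if v = a then card V - 2 else if v = b then card V - 1 else 0)" for v
  have "card {a, b, w} \<le> card V" by (rule card_mono[OF assms(1,3)])
  then have card_V: "3 \<le> card V" using abw(1) by simp
  obtain f where f: "bij_betw f V {..<card V}" and "\<And>v. v \<in> {a, b, w} \<Longrightarrow> f v = g v"
    by (rule bij_betw_extend[of V "{..<card V}" "{a, b, w}" g])
      (use assms card_V in \<open>auto simp: g_def inj_on_def\<close>)
  then have f_abw: "f a = card V - 2" "f b = card V - 1" "f w = 0"
    using abw(1) by (auto simp: g_def)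
  have "adj_entry (C3neg_dot_K (card V)) (f u) (f v) = triangle_clique_entry a b w u v"
    if "u \<in> V" "v \<in> V" for u v
  proof -
    have "adj_entry (C3neg_dot_K (card V)) (f u) (f v)
        = triangle_clique_entry (f a) (f b) (f w) (f u) (f v)"
      using adj_entry_C3neg_dot_K[OF card_V] bij_betw_apply[OF f] that by (simp add: f_abw)
    also have "\<dots> = triangle_clique_entry a b w u v"
      using f abw that by (intro triangle_clique_entry_inj_on) (auto simp: bij_betw_def)
    finally show ?thesis .
  qed
  then show thesis using that f by blast
qed

lemma quadratic_form_triangle_clique_le:
  assumes "finite V" and abw: "distinct [a, b, w]" "{a, b, w} \<subseteq> V"
  shows "quadratic_form V (triangle_clique_entry a b w) g
    \<le> sg_spectral_radius (C3neg_dot_K (card V)) * norm_sq V g"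
proof -
  let ?K = "C3neg_dot_K (card V)"
  obtain f where f: "bij_betw f V {..<card V}"
    and adj: "\<And>u v. u \<in> V \<Longrightarrow> v \<in> V \<Longrightarrow>
      adj_entry ?K (f u) (f v) = triangle_clique_entry a b w u v"
    using C3neg_dot_K_labelling[OF assms] by blast
  define h where "h i = g (inv_into V f i)" for i
  have h: "1 * h (f v) = g v" if "v \<in> V" for v
    using bij_betw_inv_into_left[OF f that] by (simp add: h_def)
  have "quadratic_form V (triangle_clique_entry a b w) g
      = quadratic_form {..<card V} (adj_entry ?K) h"
    using quadratic_form_reindex[OF f, of "adj_entry ?K" "\<lambda>_. 1" "triangle_clique_entry a b w" h]
      adj quadratic_form_cong[of V "\<lambda>v. 1 * h (f v)" g, OF h]
    by (simp add: switched_def)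
  also have "\<dots> \<le> sg_spectral_radius ?K * norm_sq {..<card V} h"
    using rayleigh_le_sg_spectral_radius[of ?K h] abw assms(1) by (auto simp: lessThan_empty_iff)
  also have "norm_sq {..<card V} h = norm_sq V g"
    using norm_sq_reindex[OF f, of "\<lambda>_. 1" h] norm_sq_cong[OF h] by (simp add: sign_function_def)
  finally show ?thesis .
qed

lemma sg_spectral_radius_C3neg_dot_K_gt:
  assumes "3 \<le> n"
  shows "real n - 3 < sg_spectral_radius (C3neg_dot_K n)"
proof -
  let ?E = "triangle_clique_entry (n - 2) (n - 1) 0" and ?\<rho> = "sg_spectral_radius (C3neg_dot_K n)"
  have E: "distinct [n - 2, n - 1, 0]" "{n - 2, n - 1, 0} \<subseteq> {..<n}" using assms by auto
  then obtain g where "(real n - 3) * norm_sq {..<n} g < quadratic_form {..<n} ?E g"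
    using ex_quadratic_form_triangle_clique_gt[of "{..<n}" "n - 2" "n - 1" 0] by auto
  also have "\<dots> \<le> ?\<rho> * norm_sq {..<n} g"
    using quadratic_form_triangle_clique_le[OF _ E, of g] by simp
  finally show ?thesis by (rule mult_right_less_imp_less) (rule norm_sq_nonneg)
qed

section \<open>Matrices with a large eigenvalue\<close>

lemma path_through_common_neighbours:
  assumes nbr: "\<And>p q X. p \<in> H \<Longrightarrow> q \<in> H \<Longrightarrow> finite X \<Longrightarrow> card X \<le> N \<Longrightarrow>
      \<exists>w\<in>H - X. R p w \<and> R w q"
    and "1 \<le> m" and "p \<in> H" and q: "q \<in> H" and "p \<noteq> q" and "finite F" and "card F + m < N"
  shows "\<exists>ws. length ws = m \<and> distinct (p # ws @ [q]) \<and> set ws \<subseteq> H - F \<and>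
    successively R (p # ws @ [q])"
  using assms(2,3,5,6,7)
proof (induction m arbitrary: p F rule: nat_induct_at_least)
  case base
  then have "card (insert p (insert q F)) \<le> N" by (auto simp: card_insert_if)
  then obtain w where "w \<in> H - insert p (insert q F)" "R p w" "R w q"
    using nbr[OF \<open>p \<in> H\<close> q, of "insert p (insert q F)"] \<open>finite F\<close> by blast
  then show ?case using \<open>p \<noteq> q\<close> by (intro exI[of _ "[w]"]) auto
next
  case (Suc m)
  then have "card (insert p (insert q F)) \<le> N" by (auto simp: card_insert_if)
  then obtain w where w: "w \<in> H - insert p (insert q F)" "R p w"
    using nbr[OF \<open>p \<in> H\<close> \<open>p \<in> H\<close>, of "insert p (insert q F)"] \<open>finite F\<close> by blast
  have "card (insert p F) + m < N" using Suc.prems by (auto simp: card_insert_if)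
  then obtain ws where "length ws = m" "distinct (w # ws @ [q])" "set ws \<subseteq> H - insert p F"
    "successively R (w # ws @ [q])"
    using Suc.IH[of w "insert p F"] w \<open>finite F\<close> by blast
  then show ?case using w \<open>p \<noteq> q\<close> by (intro exI[of _ "w # ws"]) auto
qed

locale near_complete = signed_matrix V A
  for V :: "'a set" and A :: "'a \<Rightarrow> 'a \<Rightarrow> real" +
  fixes x :: "'a \<Rightarrow> real" and r :: real and k :: nat
  assumes k_ge: "3 \<le> k" and order_ge: "10 * k + 11 \<le> card V"
    and eigenvector: "eigenfunction V A r x" and r_gt: "real (card V) - 3 < r"
    and weight_nonneg: "v \<in> V \<Longrightarrow> 0 \<le> x v"
    and weight_le_1: "v \<in> V \<Longrightarrow> x v \<le> 1"
    and weight_1: "\<exists>v\<in>V. x v = 1"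
begin

definition pos_nbrs :: "'a \<Rightarrow> 'a set" where "pos_nbrs u = {v \<in> V. A u v = 1}"
definition low :: "'a set" where "low = {v \<in> V. x v < 1/3}"
definition hub :: "'a set" where "hub = {v \<in> V. 3/4 \<le> x v}"

lemma low_subset: "low \<subseteq> V"
  by (auto simp: low_def)

lemma hub_subset: "hub \<subseteq> V - low"
  by (auto simp: hub_def low_def)

lemma finite_low: "finite low"
  using low_subset finite_V by (rule finite_subset)

lemma finite_pos_nbrs: "finite (pos_nbrs u)"
  using finite_V by (simp add: pos_nbrs_def)

lemma eigenvalue_equation: "u \<in> V \<Longrightarrow> (\<Sum>v\<in>V. A u v * x v) = r * x u"
  using eigenvector by (simp add: eigenfunction_def matrix_apply_def)

lemma deficit_sum: "(\<Sum>v\<in>V. 1 - x v) < 2"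
proof -
  obtain z where z: "z \<in> V" "x z = 1" using weight_1 by blast
  have "r = (\<Sum>v\<in>V. A z v * x v)" using eigenvalue_equation[OF z(1)] z(2) by simp
  also have "\<dots> = (\<Sum>v\<in>V - {z}. A z v * x v)" using finite_V z diag by (simp add: sum.remove)
  also have "\<dots> \<le> (\<Sum>v\<in>V - {z}. x v)"
  proof (intro sum_mono)
    fix v assume "v \<in> V - {z}"
    then show "A z v * x v \<le> x v" using entries[of z v] weight_nonneg[of v] by auto
  qed
  also have "\<dots> = (\<Sum>v\<in>V. x v) - 1" using finite_V z by (simp add: sum_diff1)
  finally show ?thesis using r_gt by (simp add: sum_subtractf)
qed

lemma deficit_card:
  assumes "T \<subseteq> V" and "\<And>v. v \<in> T \<Longrightarrow> c \<le> 1 - x v"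
  shows "real (card T) * c < 2"
proof -
  have "real (card T) * c \<le> (\<Sum>v\<in>T. 1 - x v)" using sum_mono[OF assms(2)] by simp
  also have "\<dots> \<le> (\<Sum>v\<in>V. 1 - x v)"
    using assms(1) finite_V weight_le_1 by (intro sum_mono2) auto
  finally show ?thesis using deficit_sum by simp
qed

lemma card_low: "card low \<le> 2"
proof -
  have "real (card low) * (2/3) < 2" by (rule deficit_card) (auto simp: low_def)
  then show ?thesis by simp
qed

lemma card_not_hub: "card (V - hub) \<le> 7"
proof -
  have "real (card (V - hub)) * (1/4) < 2" by (rule deficit_card) (auto simp: hub_def)
  then show ?thesis by simp
qed

lemma card_Int_hub:
  assumes "S \<subseteq> V"
  shows "card S \<le> card (S \<inter> hub) + 7"
proof -
  have "card S \<le> card ((S \<inter> hub) \<union> (V - hub))"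
    using assms finite_V by (intro card_mono) (auto intro: finite_subset)
  also have "\<dots> \<le> card (S \<inter> hub) + card (V - hub)" by (rule card_Un_le)
  finally show ?thesis using card_not_hub by linarith
qed

lemma card_pos_nbrs_ge:
  assumes "u \<in> V"
  shows "(real (card V) - 3) * x u \<le> card (pos_nbrs u)"
proof -
  have "(real (card V) - 3) * x u \<le> r * x u"
    using r_gt weight_nonneg[OF assms] by (intro mult_right_mono) auto
  also have "\<dots> = (\<Sum>v\<in>V. A u v * x v)" using eigenvalue_equation[OF assms] by simp
  also have "\<dots> \<le> (\<Sum>v\<in>V. if A u v = 1 then 1 else 0)"
  proof (intro sum_mono)
    fix v assume "v \<in> V"
    then show "A u v * x v \<le> (if A u v = 1 then 1 else 0)"
      using entries[of u v] weight_nonneg[of v] weight_le_1[of v] by auto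
  qed
  also have "\<dots> = card (pos_nbrs u)"
    using finite_V by (simp add: pos_nbrs_def sum.If_cases Int_def)
  finally show ?thesis .
qed

lemma card_hub_nbrs_ge:
  assumes "u \<in> V - low"
  shows "6 \<le> card (pos_nbrs u \<inter> hub)"
proof -
  have "real (card V) - 3 \<ge> 38" using order_ge k_ge by linarith
  moreover have "x u \<ge> 1/3" using assms by (auto simp: low_def)
  ultimately have "38 * (1/3) \<le> (real (card V) - 3) * x u" by (intro mult_mono) auto
  then have "13 \<le> card (pos_nbrs u)" using card_pos_nbrs_ge[of u] assms by simp
  then show ?thesis using card_Int_hub[of "pos_nbrs u"] by (auto simp: pos_nbrs_def)
qed

lemma ex_hub_nbr_avoiding:
  assumes "u \<in> V - low" and "finite X" and "card X \<le> 5"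
  shows "\<exists>p\<in>hub - X. A u p = 1"
proof -
  have "\<not> pos_nbrs u \<inter> hub \<subseteq> X"
    using card_hub_nbrs_ge[OF assms(1)] card_mono[OF assms(2), of "pos_nbrs u \<inter> hub"] assms(3)
    by linarith
  then show ?thesis by (auto simp: pos_nbrs_def)
qed

lemma card_common_hub_nbrs_ge:
  assumes "p \<in> hub" and "q \<in> hub"
  shows "2 * k + 3 \<le> card (pos_nbrs p \<inter> pos_nbrs q \<inter> hub)"
proof -
  have degree: "(real (card V) - 3) * (3/4) \<le> card (pos_nbrs u)" if "u \<in> hub" for u
  proof -
    have "(real (card V) - 3) * (3/4) \<le> (real (card V) - 3) * x u"
      using that order_ge by (intro mult_left_mono) (auto simp: hub_def)
    then show ?thesis using card_pos_nbrs_ge[of u] that by (auto simp: hub_def)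
  qed
  have "card (pos_nbrs p) + card (pos_nbrs q)
      = card (pos_nbrs p \<union> pos_nbrs q) + card (pos_nbrs p \<inter> pos_nbrs q)"
    using finite_pos_nbrs by (intro card_Un_Int)
  also have "\<dots> \<le> card V + (card (pos_nbrs p \<inter> pos_nbrs q \<inter> hub) + 7)"
    using finite_V by (intro add_mono card_mono card_Int_hub) (auto simp: pos_nbrs_def)
  finally have "real (card (pos_nbrs p)) + real (card (pos_nbrs q))
      \<le> real (card V) + real (card (pos_nbrs p \<inter> pos_nbrs q \<inter> hub)) + 7"
    by linarith
  then have "real (card V) / 2 - 23/2 \<le> real (card (pos_nbrs p \<inter> pos_nbrs q \<inter> hub))"
    using degree[OF assms(1)] degree[OF assms(2)] by argo
  then show ?thesis using order_ge k_ge by linarith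
qed

lemma ex_common_hub_nbr_avoiding:
  assumes "p \<in> hub" and "q \<in> hub" and "finite X" and "card X \<le> 2 * k + 2"
  shows "\<exists>w\<in>hub - X. A p w = 1 \<and> A w q = 1"
proof -
  have "\<not> pos_nbrs p \<inter> pos_nbrs q \<inter> hub \<subseteq> X"
    using card_common_hub_nbrs_ge[OF assms(1,2)] assms(4)
      card_mono[OF assms(3), of "pos_nbrs p \<inter> pos_nbrs q \<inter> hub"] by linarith
  then show ?thesis by (auto simp: pos_nbrs_def sym[of q])
qed

lemma positive_path:
  assumes u: "u \<in> V - low - F" and v: "v \<in> V - low - F" and "u \<noteq> v"
    and F: "finite F" "card F \<le> 2" and l: "5 \<le> l" "l \<le> 2 * k + 1"
  obtains P where "length P = l" "hd P = u" "last P = v" "distinct P" "set P \<subseteq> V - F"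
    "successively (\<lambda>u v. A u v = 1) P"
proof -
  have "card (insert v F) \<le> 5" using F by (auto simp: card_insert_if)
  then obtain p where p: "p \<in> hub - insert v F" "A u p = 1"
    using ex_hub_nbr_avoiding[of u "insert v F"] u F by blast
  have "card (insert u (insert p F)) \<le> 5" using F by (auto simp: card_insert_if)
  then obtain q where q: "q \<in> hub - insert u (insert p F)" "A v q = 1"
    using ex_hub_nbr_avoiding[of v "insert u (insert p F)"] v F by blast
  have "p \<noteq> u" "q \<noteq> v" using p q diag by auto
  have "card (insert u (insert v F)) + (l - 4) < 2 * k + 2"
    using F l by (auto simp: card_insert_if)
  then have "\<exists>ws. length ws = l - 4 \<and> distinct (p # ws @ [q]) \<and>
      set ws \<subseteq> hub - insert u (insert v F) \<and> successively (\<lambda>u v. A u v = 1) (p # ws @ [q])"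
    using p q F l
    by (intro path_through_common_neighbours[OF ex_common_hub_nbr_avoiding]) auto
  then obtain ws where ws: "length ws = l - 4" "distinct (p # ws @ [q])"
    "set ws \<subseteq> hub - insert u (insert v F)" "successively (\<lambda>u v. A u v = 1) (p # ws @ [q])"
    by blast
  show thesis
  proof (rule that[of "u # (p # ws @ [q]) @ [v]"])
    show "length (u # (p # ws @ [q]) @ [v]) = l" using ws(1) l by simp
    show "distinct (u # (p # ws @ [q]) @ [v])"
      using \<open>u \<noteq> v\<close> \<open>p \<noteq> u\<close> \<open>q \<noteq> v\<close> p q ws(2,3) by auto
    show "set (u # (p # ws @ [q]) @ [v]) \<subseteq> V - F" using u v p q ws(3) hub_subset by auto
    have "successively (\<lambda>u v. A u v = 1) ((p # ws @ [q]) @ [v])"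
      unfolding successively_append_iff using ws(4) q(2) by (auto simp: sym[of q v])
    then show "successively (\<lambda>u v. A u v = 1) (u # (p # ws @ [q]) @ [v])" using p by simp
  qed simp_all
qed

lemma ex_positive_cycle:
  "\<exists>vs. length vs = 2 * k + 1 \<and> distinct vs \<and> set vs \<subseteq> V \<and> cycle_prod A vs = 1"
proof -
  obtain z where "z \<in> V" "x z = 1" using weight_1 by blast
  then have z: "z \<in> V - low" by (simp add: low_def)
  obtain v where v: "v \<in> hub" "A z v = 1" using ex_hub_nbr_avoiding[OF z, of "{}"] by auto
  then have "v \<in> V - low" "z \<noteq> v" using hub_subset diag by auto
  then obtain P where P: "length P = 2 * k + 1" "hd P = z" "last P = v" "distinct P"
      "set P \<subseteq> V - {}" "successively (\<lambda>u v. A u v = 1) P"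
    using positive_path[of z "{}" v "2 * k + 1"] z k_ge by auto
  then have "cycle_prod A P = 1"
    using cycle_prod_append_positive_path[OF P(6), of "[]"] v(2) sym[of v z] by fastforce
  then show ?thesis using P by auto
qed

end

lemma (in signed_matrix) near_complete_switched:
  assumes "3 \<le> k" and "10 * k + 11 \<le> card V"
    and f: "eigenfunction V A r f" and "real (card V) - 3 < r"
  obtains t x where "sign_function t" and "near_complete V (switched t A) x r k"
proof -
  obtain t x where t: "sign_function t" and "eigenfunction V (switched t A) r x"
    and "\<And>v. v \<in> V \<Longrightarrow> 0 \<le> x v \<and> x v \<le> 1" and "\<exists>v\<in>V. x v = 1"
    using eigenfunction_normalize[OF finite_V f] by metis
  then have "near_complete V (switched t A) x r k"
    using assms signed_matrix_switched[OF t]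
    by (simp add: near_complete_def near_complete_axioms_def)
  then show thesis using that t by blast
qed

lemma (in signed_matrix) uminus_not_eigenvalue_if_no_negative_cycle:
  assumes "3 \<le> k" and "10 * k + 11 \<le> card V" and "real (card V) - 3 < r"
    and free: "no_negative_cycle (2 * k + 1) V A"
  shows "\<not> eigenfunction V (\<lambda>u v. - A u v) r f"
proof
  assume "eigenfunction V (\<lambda>u v. - A u v) r f"
  then obtain t x where t: "sign_function t"
    and "near_complete V (switched t (\<lambda>u v. - A u v)) x r k"
    using signed_matrix.near_complete_switched[OF signed_matrix_uminus assms(1,2)] assms(3) by metis
  then obtain vs where vs: "length vs = 2 * k + 1" "distinct vs" "set vs \<subseteq> V"
    and "cycle_prod (switched t (\<lambda>u v. - A u v)) vs = 1"
    using near_complete.ex_positive_cycle by blast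
  then have "cycle_prod A vs = -1" by (simp add: cycle_prod_switched[OF t] cycle_prod_uminus)
  then show False using free vs unfolding no_negative_cycle_def by blast
qed

locale near_complete_unbalanced = near_complete +
  assumes no_neg_cycle: "no_negative_cycle (2 * k + 1) V A"
    and unbalanced: "\<not> balanced_matrix V A"
begin

lemma closing_walk_not_negative:
  assumes "u \<in> V - low - set ws" "v \<in> V - low - set ws" "u \<noteq> v"
    and ws: "distinct ws" "set ws \<subseteq> V" "length ws \<le> 2"
  shows "walk_prod A (v # ws @ [u]) \<noteq> -1"
proof
  assume neg: "walk_prod A (v # ws @ [u]) = -1"
  obtain P where P: "length P = 2 * k + 1 - length ws" "hd P = u" "last P = v" "distinct P"
      "set P \<subseteq> V - set ws" "successively (\<lambda>u v. A u v = 1) P"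
    by (rule positive_path[OF assms(1-3), of "2 * k + 1 - length ws"])
      (use ws k_ge in \<open>auto simp: distinct_card\<close>)
  then have "cycle_prod A (P @ ws) = -1"
    using cycle_prod_append_positive_path[OF P(6), of ws] neg ws(3) k_ge by force
  moreover have "length (P @ ws) = 2 * k + 1" "distinct (P @ ws)" "set (P @ ws) \<subseteq> V"
    using P ws k_ge by auto
  ultimately show False using no_neg_cycle unfolding no_negative_cycle_def by blast
qed

lemma nonneg_outside_low:
  assumes "u \<in> V - low" "v \<in> V - low"
  shows "0 \<le> A u v"
proof (cases "u = v")
  case False
  then show ?thesis using closing_walk_not_negative[of v "[]" u] assms entries[of u v] by auto
qed (simp add: diag)

lemma low_vertex_one_sign:
  assumes "a \<in> low" and "u \<in> V - low" "v \<in> V - low" and "A a u = 1"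
  shows "A a v \<noteq> -1"
proof
  assume "A a v = -1"
  moreover from this have "u \<noteq> v" using assms(4) by auto
  ultimately show False
    using closing_walk_not_negative[of u "[a]" v] assms low_subset by (auto simp: sym[of v a])
qed

definition low_sign :: "'a \<Rightarrow> real" where
  "low_sign v = (if v \<in> low \<and> (\<exists>u\<in>V - low. A v u = -1) then -1 else 1)"

abbreviation flipped :: "'a \<Rightarrow> 'a \<Rightarrow> real" where
  "flipped \<equiv> switched low_sign A"

lemma sign_function_low_sign: "sign_function low_sign"
  by (simp add: sign_function_def low_sign_def)

lemma low_sign_outside: "v \<notin> low \<Longrightarrow> low_sign v = 1"
  by (simp add: low_sign_def)

sublocale flipped: signed_matrix V flipped
  by (rule signed_matrix_switched[OF sign_function_low_sign])

lemma flipped_nonneg: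
  assumes uv: "u \<in> V" "v \<in> V" "u \<notin> low \<or> v \<notin> low"
  shows "0 \<le> flipped u v"
proof -
  have low_case: "0 \<le> flipped a p" if "a \<in> low" "p \<in> V - low" for a p
    using low_vertex_one_sign[of a _ p] low_vertex_one_sign[of a p] that entries[of a p]
    by (auto simp: switched_def low_sign_def)
  consider "u \<notin> low" "v \<notin> low" | "u \<in> low" "v \<notin> low" | "u \<notin> low" "v \<in> low" using uv by blast
  then show ?thesis
  proof cases
    case 1
    then show ?thesis using nonneg_outside_low uv by (simp add: switched_def low_sign_outside)
  next
    case 2
    then show ?thesis using low_case uv by blast
  next
    case 3
    then show ?thesis using low_case[of v u] uv by (simp add: flipped.sym[of u v])
  qed
qed

lemma low_pair:
  obtains a b where "a \<noteq> b" and "low = {a, b}" and "flipped a b = -1"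
proof -
  obtain a b where ab: "a \<in> V" "b \<in> V" "flipped a b < 0"
    using unbalanced sign_function_low_sign unfolding balanced_matrix_def by (meson not_le)
  then have "a \<in> low" "b \<in> low" using flipped_nonneg[of a b] by auto
  moreover have "a \<noteq> b" using ab(3) flipped.diag[of a] by auto
  ultimately have "low = {a, b}" using card_seteq[OF finite_low, of "{a, b}"] card_low by simp
  then show thesis using that[of a b] \<open>a \<noteq> b\<close> ab(3) flipped.entries[of a b] by auto
qed

lemma low_vertex_attached:
  assumes "a \<noteq> b" and low: "low = {a, b}" and ab: "flipped a b = -1"
  shows "\<exists>p\<in>V - low. flipped a p = 1"
proof (rule ccontr)
  assume isolated: "\<not> ?thesis"
  have "flipped a v \<le> 0" if "v \<in> V" for v
  proof (cases "v \<in> low")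
    case True
    then show ?thesis using low ab flipped.diag[of a] by auto
  next
    case False
    then show ?thesis using isolated that flipped.entries[of a v] by auto
  qed
  moreover have "0 \<le> flipped u v" if "u \<in> V - {a}" "v \<in> V - {a}" for u v
    using flipped_nonneg[of u v] flipped.diag[of u] that low by (cases "u = v") auto
  ultimately have "balanced_matrix V flipped" by (rule flipped.balanced_matrix_if_nonpos_row)
  then show False using unbalanced balanced_matrix_switchedD[OF sign_function_low_sign] by blast
qed

lemma low_pair_common_nbr:
  assumes "a \<noteq> b" and low: "low = {a, b}" and ab: "flipped a b = -1"
    and pq: "p \<in> V - low" "q \<in> V - low" "flipped a p = 1" "flipped b q = 1"
  shows "p = q"
proof (rule ccontr)
  assume "p \<noteq> q"
  have "walk_prod flipped (p # [a, b] @ [q]) = -1"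
    using ab pq flipped.sym[of p a] by simp
  then have "walk_prod A (p # [a, b] @ [q]) = -1"
    using walk_prod_switched[OF sign_function_low_sign, of A p "[a, b] @ [q]"] pq
    by (simp add: low_sign_outside)
  then show False
    using closing_walk_not_negative[of q "[a, b]" p] \<open>p \<noteq> q\<close> \<open>a \<noteq> b\<close> pq low low_subset by auto
qed

lemma low_rows_eq_triangle_clique:
  obtains a b w where "distinct [a, b, w]" and "w \<in> V" and "low = {a, b}"
    and "\<And>u v. u \<in> low \<Longrightarrow> v \<in> V \<Longrightarrow> flipped u v = triangle_clique_entry a b w u v"
proof -
  obtain a b where "a \<noteq> b" and low: "low = {a, b}" and ab: "flipped a b = -1" by (rule low_pair)
  then have ba: "b \<noteq> a" "low = {b, a}" "flipped b a = -1" by (auto simp: flipped.sym[of b a])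
  note common_nbr = low_pair_common_nbr[OF \<open>a \<noteq> b\<close> low ab]
  obtain w where w: "w \<in> V - low" "flipped a w = 1"
    using low_vertex_attached[OF \<open>a \<noteq> b\<close> low ab] by blast
  obtain w' where "w' \<in> V - low" "flipped b w' = 1" using low_vertex_attached[OF ba] by blast
  then have bw: "flipped b w = 1" using common_nbr[OF w(1) _ w(2)] by blast
  have zero: "flipped a v = 0 \<and> flipped b v = 0" if "v \<in> V - {a, b, w}" for v
    using that common_nbr[of v w] common_nbr[of w v] w bw low low_subset
      flipped_nonneg[of a v] flipped_nonneg[of b v] flipped.entries[of a v] flipped.entries[of b v]
    by auto
  have "flipped u v = triangle_clique_entry a b w u v" if uv: "u \<in> low" "v \<in> V" for u v
  proof -
    have "u = a \<or> u = b" using uv low by simp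
    then consider "v = u" | "u = a" "v = b" | "u = b" "v = a" | "v = w" | "v \<in> V - {a, b, w}"
      using uv by blast
    then show ?thesis using \<open>a \<noteq> b\<close> ab ba w bw zero uv low flipped.diag
      by cases (auto simp: triangle_clique_entry_def doubleton_eq_iff)
  qed
  then show thesis using that[of a b w] \<open>a \<noteq> b\<close> w low by auto
qed

lemma flipped_le_triangle_clique:
  obtains a b w where "distinct [a, b, w]" and "{a, b, w} \<subseteq> V"
    and "\<And>u v. u \<in> V \<Longrightarrow> v \<in> V \<Longrightarrow> flipped u v = triangle_clique_entry a b w u v \<or>
      u \<notin> low \<and> v \<notin> low \<and> flipped u v < triangle_clique_entry a b w u v"
proof -
  obtain a b w where abw: "distinct [a, b, w]" "w \<in> V" and low: "low = {a, b}"
    and low_row: "\<And>u v. u \<in> low \<Longrightarrow> v \<in> V \<Longrightarrow> flipped u v = triangle_clique_entry a b w u v"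
    using low_rows_eq_triangle_clique by blast
  let ?E = "triangle_clique_entry a b w"
  have "flipped u v = ?E u v \<or> u \<notin> low \<and> v \<notin> low \<and> flipped u v < ?E u v"
    if uv: "u \<in> V" "v \<in> V" for u v
  proof (cases "u \<in> low \<or> v \<in> low")
    case True
    then show ?thesis using low_row uv flipped.sym triangle_clique_entry_sym by metis
  next
    case False
    then have "?E u v = (if u = v then 0 else 1)" using low by (simp add: triangle_clique_entry_def)
    then show ?thesis using False flipped.diag[of u] flipped.entries[of u v] by auto
  qed
  then show thesis using that[OF abw(1)] abw(2) low low_subset by auto
qed

lemma quadratic_form_flipped:
  "quadratic_form V flipped (\<lambda>v. low_sign v * x v) = r * norm_sq V x"
proof -
  have "quadratic_form V A x = quadratic_form V flipped (\<lambda>v. low_sign v * x v)"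
    using quadratic_form_reindex[of id V V A low_sign flipped x]
      sign_function_square[OF sign_function_low_sign]
    by (simp add: switched_switched) (simp add: switched_def)
  then show ?thesis using quadratic_form_eigenfunction[OF eigenvector] by simp
qed

lemma flipped_eq_triangle_clique:
  assumes radius: "\<And>a b w g. distinct [a, b, w] \<Longrightarrow> {a, b, w} \<subseteq> V \<Longrightarrow>
    quadratic_form V (triangle_clique_entry a b w) g \<le> r * norm_sq V g"
  shows "\<exists>a b w. distinct [a, b, w] \<and> {a, b, w} \<subseteq> V \<and>
    (\<forall>u\<in>V. \<forall>v\<in>V. flipped u v = triangle_clique_entry a b w u v)"
proof -
  obtain a b w where abw: "distinct [a, b, w]" "{a, b, w} \<subseteq> V"
    and le: "\<And>u v. u \<in> V \<Longrightarrow> v \<in> V \<Longrightarrow> flipped u v = triangle_clique_entry a b w u v \<or>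
      u \<notin> low \<and> v \<notin> low \<and> flipped u v < triangle_clique_entry a b w u v"
    using flipped_le_triangle_clique by blast
  let ?y = "\<lambda>v. low_sign v * x v"
  have y_pos: "0 < ?y v" if "v \<in> V" "v \<notin> low" for v
    using that by (simp add: low_sign_outside) (simp add: low_def)
  have "flipped u v = triangle_clique_entry a b w u v" if "u \<in> V" "v \<in> V" for u v
  proof (rule ccontr)
    assume "flipped u v \<noteq> triangle_clique_entry a b w u v"
    then have "quadratic_form V flipped ?y < quadratic_form V (triangle_clique_entry a b w) ?y"
      using le y_pos that by (intro quadratic_form_strict_mono[OF finite_V, of _ _ _ u v]) blast+
    also have "\<dots> \<le> r * norm_sq V ?y" by (rule radius[OF abw])
    also have "norm_sq V ?y = norm_sq V x"
      using norm_sq_reindex[of id V V low_sign x] sign_function_low_sign by simp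
    finally show False by (simp add: quadratic_form_flipped)
  qed
  then show ?thesis using abw by blast
qed

end

section \<open>The extremal bound\<close>

lemma (in signed_matrix) switched_eq_triangle_clique_if_large_eigenvalue:
  assumes k: "3 \<le> k" "10 * k + 11 \<le> card V"
    and f: "eigenfunction V A r f"
    and large: "sg_spectral_radius (C3neg_dot_K (card V)) \<le> r"
    and free: "no_negative_cycle (2 * k + 1) V A" and unbal: "\<not> balanced_matrix V A"
  obtains t a b w where "sign_function t" "distinct [a, b, w]" "{a, b, w} \<subseteq> V"
    "\<And>u v. u \<in> V \<Longrightarrow> v \<in> V \<Longrightarrow> switched t A u v = triangle_clique_entry a b w u v"
proof -
  have "real (card V) - 3 < r" using sg_spectral_radius_C3neg_dot_K_gt[of "card V"] large k by simp
  then obtain t x where t: "sign_function t" and near: "near_complete V (switched t A) x r k"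
    using near_complete_switched[OF k f] by blast
  interpret normalized: near_complete_unbalanced V "switched t A" x r k
    using near free unbal balanced_matrix_switchedD[OF t]
    by (auto simp: near_complete_unbalanced_def near_complete_unbalanced_axioms_def
        no_negative_cycle_switched[OF t])
  have "quadratic_form V (triangle_clique_entry a b w) g \<le> r * norm_sq V g"
    if "distinct [a, b, w]" "{a, b, w} \<subseteq> V" for a b w g
    using quadratic_form_triangle_clique_le[OF finite_V that, of g]
      mult_right_mono[OF large norm_sq_nonneg[of V g]] by linarith
  then obtain a b w where "distinct [a, b, w]" "{a, b, w} \<subseteq> V"
    and "\<forall>u\<in>V. \<forall>v\<in>V. normalized.flipped u v = triangle_clique_entry a b w u v"
    using normalized.flipped_eq_triangle_clique by blast
  then show thesis
    using that[OF sign_function_mult[OF normalized.sign_function_low_sign t]]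
    by (simp add: switched_switched)
qed

lemma switching_equivalent_C3neg_dot_K_if_switched_eq:
  assumes G: "signed_graph G" and "3 \<le> sg_order G"
    and t: "sign_function t" and abw: "distinct [a, b, w]" "{a, b, w} \<subseteq> sg_verts G"
    and eq: "\<And>u v. u \<in> sg_verts G \<Longrightarrow> v \<in> sg_verts G \<Longrightarrow>
      switched t (adj_entry G) u v = triangle_clique_entry a b w u v"
  shows "switching_equivalent G (C3neg_dot_K (sg_order G))"
proof -
  have "finite (sg_verts G)" using G by (simp add: signed_graph_def)
  then obtain f where "bij_betw f (sg_verts G) {..<sg_order G}"
    and "\<And>u v. u \<in> sg_verts G \<Longrightarrow> v \<in> sg_verts G \<Longrightarrow>
      adj_entry (C3neg_dot_K (sg_order G)) (f u) (f v) = triangle_clique_entry a b w u v"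
    using C3neg_dot_K_labelling[OF _ abw] unfolding sg_order_def by metis
  then show ?thesis
    unfolding switching_equivalent_iff[OF G signed_graph_C3neg_dot_K[OF assms(2)]]
    using t eq by (intro exI[of _ t] exI[of _ f]) simp
qed

lemma switching_equivalent_C3neg_dot_K_if_large_radius:
  assumes G: "signed_graph G" and order: "sg_order G = n" and unbal: "\<not> balanced G"
    and k: "3 \<le> k" "10 * k + 11 \<le> n" and free: "negative_cycle_free (2 * k + 1) G"
    and large: "sg_spectral_radius (C3neg_dot_K n) \<le> sg_spectral_radius G"
  shows "switching_equivalent G (C3neg_dot_K n)"
proof -
  let ?V = "sg_verts G" and ?A = "adj_entry G" and ?r = "sg_spectral_radius G"
  interpret signed_matrix ?V ?A by (rule signed_matrix_adj_entry[OF G])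
  have card_V: "card ?V = n" using order by (simp add: sg_order_def)
  have no_neg: "no_negative_cycle (2 * k + 1) ?V ?A"
    using no_negative_cycle_adj_entry[OF G free] k by simp
  have "real n - 3 < ?r" using sg_spectral_radius_C3neg_dot_K_gt[of n] k large by simp
  then have "\<not> eigenfunction ?V (\<lambda>u v. - ?A u v) ?r f" for f
    using uminus_not_eigenvalue_if_no_negative_cycle[OF k(1)] k(2) no_neg by (simp add: card_V)
  moreover have "?V \<noteq> {}" using card_V k by auto
  ultimately obtain f where "eigenfunction ?V ?A ?r f"
    using sg_spectral_radius_eigenfunction[OF finite_V] by blast
  then obtain t a b w where "sign_function t" "distinct [a, b, w]" "{a, b, w} \<subseteq> ?V"
    "\<And>u v. u \<in> ?V \<Longrightarrow> v \<in> ?V \<Longrightarrow> switched t ?A u v = triangle_clique_entry a b w u v"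
    using switched_eq_triangle_clique_if_large_eigenvalue[OF k(1) _ _ _ no_neg] k(2) large card_V
      balanced_if_balanced_matrix[OF G] unbal by metis
  then show ?thesis
    using switching_equivalent_C3neg_dot_K_if_switched_eq[OF G] order k by auto
qed

theorem theorem1p4:
  fixes G :: "'a sgraph" and n k :: nat
  assumes "signed_graph G"
    and "sg_order G = n"
    and "\<not> balanced G"
    and "3 \<le> k" and "real k \<le> (real n - 11) / 10"
    and "negative_cycle_free (2 * k + 1) G"
  shows "sg_spectral_radius G \<le> sg_spectral_radius (C3neg_dot_K n) \<and>
    (sg_spectral_radius G = sg_spectral_radius (C3neg_dot_K n) \<longleftrightarrow>
      switching_equivalent G (C3neg_dot_K n))"
proof -
  let ?K = "C3neg_dot_K n"
  have "real (10 * k + 11) \<le> real n" using assms(5) by simp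
  then have n: "10 * k + 11 \<le> n" by linarith
  then have K: "signed_graph ?K" by (intro signed_graph_C3neg_dot_K) simp
  have "switching_equivalent G ?K" if "sg_spectral_radius ?K \<le> sg_spectral_radius G"
    using switching_equivalent_C3neg_dot_K_if_large_radius[OF assms(1-4) n assms(6) that] .
  then show ?thesis
    using sg_spectral_radius_switching_equivalent[OF assms(1) K] by fastforce
qed

end
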